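(* Let $l\ge2$ and let the discrete space be either $V_h^l$ or $W_h^l$. Assume that the semi-discrete discontinuous Galerkin solution of the nonlinear Vlasov–Poisson system satisfies $f_h(x,\pm V_c,t)=0$. Then $$\frac{d}{dt}\left(\frac12\sum_{i,j}\int_{I_{i,j}}f_hv^2\,dx\,dv+\frac12\sum_i\int_{J_i}E_h^2(x)\,dx\right)=A(f_h,\Phi_h)=A(f_h-f,\ \Phi_h-P(\Phi_h)),$$ where $f$ is the exact solution, the operator $A$ is $$A(w,u):=\sum_{i,j}\int_{I_{i,j}}\big(w\,u_x\,v-(w)_t\,u\big)\,dx\,dv,$$ and $P$ is any projection such that $P(\Phi_h)\in Z_h^l$ and $P(\Phi_h)=\Phi_h$ at $x_{i+1/2}$ for $i=0,1,\ldots,N_x$.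
   Context: Equation: the one-dimensional Vlasov–Poisson system $\partial_tf+v f_x-Ef_v=0$, $-\Phi_{xx}=1-\int f\,dv$, $E=-\Phi_x$, periodic in $x\in[0,L]$, with velocity domain truncated to $[-V_c,V_c]$; $V_c$ is chosen so large that the exact (classical) solution satisfies $f(x,v,t)=0$ for $|v|\ge V_c$. Mesh: $0=x_{1/2}<x_{3/2}<\dots<x_{N_x+1/2}=L$, $-V_c=v_{1/2}<\dots<v_{N_v+1/2}=V_c$; $J_i=[x_{i-1/2},x_{i+1/2}]$, $K_j=[v_{j-1/2},v_{j+1/2}]$, $I_{i,j}=J_i\times K_j$, $1\le i\le N_x$, $1\le j\le N_v$. The mesh is chosen such that $v$ has a single sign in each $K_j$. All functions of $x$ are extended periodically (traces at $x_{1/2}$ and $x_{N_x+1/2}$ are identified accordingly). Spaces: $Z_h^l$ is the set of functions on $[0,L]$ whose restriction to each $J_i$ is a polynomial of degree at most $l$. $V_h^l$ is the set of functions whose restriction to each $I_{i,j}$ lies in $\mathbb{Q}^l=\mathrm{span}\{x^{l_1}v^{l_2}:0\le l_1,l_2\le l\}$; $W_h^l$ is the same with $\mathbb{P}^l=\mathrm{span}\{x^{l_1}v^{l_2}:l_1,l_2\ge0,\ l_1+l_2\le l\}$. Notation: $(\varphi)^\pm_{i+1/2,v}=\lim_{\epsilon\to0^+}\varphi(x_{i+1/2}\pm\epsilon,v)$, $(\varphi)^\pm_{x,j+1/2}=\lim_{\epsilon\to0^+}\varphi(x,v_{j+1/2}\pm\epsilon)$. Upwind fluxes: $\widehat{vf_h}=vf_h^-$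 if $v\ge0$ in $K_j$, $\widehat{vf_h}=vf_h^+$ if $v<0$ in $K_j$; $\widehat{E_hf_h}=E_hf_h^-$ if $\int_{J_i}E_h\,dx\le0$, $\widehat{E_hf_h}=E_hf_h^+$ if $\int_{J_i}E_h\,dx>0$. The assumption $f_h(x,\pm V_c,t)=0$ means that both traces of $f_h$ at $v=\pm V_c$ (interior and exterior) vanish, so the fluxes $\widehat{E_hf_h}$ there are zero. Semi-discrete scheme: $f_h(\cdot,\cdot,t)$ lies in the discrete space and, for all test functions $\varphi_h$ in the discrete space and all $i,j$, $$\int_{I_{i,j}}(f_h)_t\varphi_h\,dx\,dv-\int_{I_{i,j}}vf_h(\varphi_h)_x\,dx\,dv+\int_{K_j}(\widehat{vf_h}\varphi_h^-)_{i+\frac12,v}\,dv-\int_{K_j}(\widehat{vf_h}\varphi_h^+)_{i-\frac12,v}\,dv+\int_{I_{i,j}}E_hf_h(\varphi_h)_v\,dx\,dv-\int_{J_i}(\widehat{E_hf_h}\varphi_h^-)_{x,j+\frac12}\,dx+\int_{J_i}(\widehat{E_hf_h}\varphi_h^+)_{x,j-\frac12}\,dx=0.$$ No positivity-preserving limiter is used. Electric field (exact Poisson solver): with $\rho_h(x,t)=\int_{-V_c}^{V_c}f_h\,dv$, $\Phi_h=\int_0^x\int_0^s\rho_h(z,t)\,dz\,ds-\frac{x^2}{2}-C_Ex$, $C_E=-\frac L2+\frac1L\int_0^L\int_0^s\rho_h(z,t)\,dz\,ds$, $E_h=-(\Phi_h)_x=C_E+x-\int_0^x\rho_h(z,t)\,dz$;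 thus $\Phi_h(0)=\Phi_h(L)=0$. Standing assumption (charge neutrality): $\int_0^L\rho_h\,dx=L$ at the initial time. Under the velocity boundary condition the scheme conserves total charge, so this holds at all times and $E_h(0)=E_h(L)$. *)

theory Defs
  imports "HOL-Analysis.Analysis"
begin

text \<open>
  Conventions. Functions of \<open>(x,v,t)\<close> are written with the time argument first, \<open>f t x v\<close>, so
  that \<open>f t\<close> is a function on phase space. Node \<open>x\<^sub>i\<^sub>+\<^sub>1\<^sub>/\<^sub>2\<close> is \<open>xn M i\<close> for \<open>0 \<le> i \<le> Nx M\<close> and
  node \<open>v\<^sub>j\<^sub>+\<^sub>1\<^sub>/\<^sub>2\<close> is \<open>vn M j\<close> for \<open>0 \<le> j \<le> Nv M\<close>; cells are indexed from 1. Time derivatives are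
  taken within \<open>{0..T}\<close>, hence one-sided at the two end points.
\<close>

record dg_mesh =
  len :: real    \<comment> \<open>the period \<open>L\<close>\<close>
  vmax :: real   \<comment> \<open>the velocity cut-off \<open>V\<^sub>c\<close>\<close>
  Nx :: nat
  Nv :: nat
  xn :: "nat \<Rightarrow> real"
  vn :: "nat \<Rightarrow> real"

definition cellJ :: "dg_mesh \<Rightarrow> nat \<Rightarrow> real set" where
  "cellJ M i = {xn M (i - 1)..xn M i}"

definition cellK :: "dg_mesh \<Rightarrow> nat \<Rightarrow> real set" where
  "cellK M j = {vn M (j - 1)..vn M j}"

definition cellI :: "dg_mesh \<Rightarrow> nat \<Rightarrow> nat \<Rightarrow> (real \<times> real) set" where
  "cellI M i j = cellJ M i \<times> cellK M j"

text \<open>The sign condition is imposed on the open cells, so that \<open>v = 0\<close> may be a node and a cell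
  \<open>[-a,0]\<close> counts as one on which \<open>v < 0\<close>.\<close>

definition valid_mesh :: "dg_mesh \<Rightarrow> bool" where
  "valid_mesh M \<longleftrightarrow>
     1 \<le> Nx M \<and> 1 \<le> Nv M \<and>
     xn M 0 = 0 \<and> xn M (Nx M) = len M \<and> strict_mono_on {0..Nx M} (xn M) \<and>
     vn M 0 = - vmax M \<and> vn M (Nv M) = vmax M \<and> strict_mono_on {0..Nv M} (vn M) \<and>
     (\<forall>j\<in>{1..Nv M}. (\<forall>v\<in>interior (cellK M j). 0 \<le> v) \<or> (\<forall>v\<in>interior (cellK M j). v < 0))"

text \<open>Discrete spaces. Members are discontinuous across cell interfaces, so the polynomial
  representation is required on the open cells only; the values on the interfaces (a null set) are
  irrelevant, and only one-sided traces are ever used there.\<close>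

definition Z_space :: "dg_mesh \<Rightarrow> nat \<Rightarrow> (real \<Rightarrow> real) set" where
  "Z_space M l = {u. \<forall>i\<in>{1..Nx M}. \<exists>p :: real poly.
     degree p \<le> l \<and> (\<forall>x\<in>interior (cellJ M i). u x = poly p x)}"

definition V_space :: "dg_mesh \<Rightarrow> nat \<Rightarrow> (real \<Rightarrow> real \<Rightarrow> real) set" where
  "V_space M l = {\<phi>. \<forall>i\<in>{1..Nx M}. \<forall>j\<in>{1..Nv M}. \<exists>c :: nat \<Rightarrow> nat \<Rightarrow> real.
     \<forall>x\<in>interior (cellJ M i). \<forall>v\<in>interior (cellK M j).
       \<phi> x v = (\<Sum>(a, b) \<in> {(a, b). a \<le> l \<and> b \<le> l}. c a b * x ^ a * v ^ b)}"

definition W_space :: "dg_mesh \<Rightarrow> nat \<Rightarrow> (real \<Rightarrow> real \<Rightarrow> real) set" where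
  "W_space M l = {\<phi>. \<forall>i\<in>{1..Nx M}. \<forall>j\<in>{1..Nv M}. \<exists>c :: nat \<Rightarrow> nat \<Rightarrow> real.
     \<forall>x\<in>interior (cellJ M i). \<forall>v\<in>interior (cellK M j).
       \<phi> x v = (\<Sum>(a, b) \<in> {(a, b). a + b \<le> l}. c a b * x ^ a * v ^ b)}"

definition trace_x_minus :: "(real \<Rightarrow> real \<Rightarrow> real) \<Rightarrow> real \<Rightarrow> real \<Rightarrow> real" where
  "trace_x_minus g a v = Lim (at_left a) (\<lambda>x. g x v)"

definition trace_x_plus :: "(real \<Rightarrow> real \<Rightarrow> real) \<Rightarrow> real \<Rightarrow> real \<Rightarrow> real" where
  "trace_x_plus g a v = Lim (at_right a) (\<lambda>x. g x v)"

definition trace_v_minus :: "(real \<Rightarrow> real \<Rightarrow> real) \<Rightarrow> real \<Rightarrow> real \<Rightarrow> real" where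
  "trace_v_minus g x b = Lim (at_left b) (g x)"

definition trace_v_plus :: "(real \<Rightarrow> real \<Rightarrow> real) \<Rightarrow> real \<Rightarrow> real \<Rightarrow> real" where
  "trace_v_plus g x b = Lim (at_right b) (g x)"

text \<open>Exact Poisson solver. The argument \<open>g\<close> is the discrete density \<open>f\<^sub>h t\<close> at a fixed time; the
  formulas are meaningful for \<open>0 \<le> x \<le> L\<close>.\<close>

definition charge_density :: "dg_mesh \<Rightarrow> (real \<Rightarrow> real \<Rightarrow> real) \<Rightarrow> real \<Rightarrow> real" where
  "charge_density M g x = integral {- vmax M..vmax M} (g x)"

definition C_E :: "dg_mesh \<Rightarrow> (real \<Rightarrow> real \<Rightarrow> real) \<Rightarrow> real" where
  "C_E M g = - len M / 2
     + 1 / len M * integral {0..len M} (\<lambda>s. integral {0..s} (charge_density M g))"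

definition potential :: "dg_mesh \<Rightarrow> (real \<Rightarrow> real \<Rightarrow> real) \<Rightarrow> real \<Rightarrow> real" where
  "potential M g x =
     integral {0..x} (\<lambda>s. integral {0..s} (charge_density M g)) - x\<^sup>2 / 2 - C_E M g * x"

definition efield :: "dg_mesh \<Rightarrow> (real \<Rightarrow> real \<Rightarrow> real) \<Rightarrow> real \<Rightarrow> real" where
  "efield M g x = C_E M g + x - integral {0..x} (charge_density M g)"

text \<open>Upwind fluxes: \<open>flux_x M g i j v\<close> is the flux through \<open>x\<^sub>i\<^sub>+\<^sub>1\<^sub>/\<^sub>2\<close> for \<open>v\<close> in \<open>K\<^sub>j\<close>, and
  \<open>flux_v M g i j x\<close> the flux through \<open>v\<^sub>j\<^sub>+\<^sub>1\<^sub>/\<^sub>2\<close> for \<open>x\<close> in \<open>J\<^sub>i\<close>.\<close>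

definition flux_x :: "dg_mesh \<Rightarrow> (real \<Rightarrow> real \<Rightarrow> real) \<Rightarrow> nat \<Rightarrow> nat \<Rightarrow> real \<Rightarrow> real" where
  "flux_x M g i j v =
     v * (if \<forall>w\<in>interior (cellK M j). 0 \<le> w
          then trace_x_minus g (xn M i) v else trace_x_plus g (xn M i) v)"

definition flux_v :: "dg_mesh \<Rightarrow> (real \<Rightarrow> real \<Rightarrow> real) \<Rightarrow> nat \<Rightarrow> nat \<Rightarrow> real \<Rightarrow> real" where
  "flux_v M g i j x =
     efield M g x * (if integral (cellJ M i) (efield M g) \<le> 0
          then trace_v_minus g x (vn M j) else trace_v_plus g x (vn M j))"

definition time_deriv ::
  "real \<Rightarrow> (real \<Rightarrow> real \<Rightarrow> real \<Rightarrow> real) \<Rightarrow> real \<Rightarrow> real \<Rightarrow> real \<Rightarrow> real" where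
  "time_deriv T f t x v = vector_derivative (\<lambda>s. f s x v) (at t within {0..T})"

text \<open>Left-hand side of the scheme on \<open>I\<^sub>i\<^sub>,\<^sub>j\<close>; \<open>g\<close> and \<open>g'\<close> stand for \<open>f\<^sub>h\<close> and \<open>(f\<^sub>h)\<^sub>t\<close> at a fixed
  time.\<close>

definition dg_form ::
  "dg_mesh \<Rightarrow> (real \<Rightarrow> real \<Rightarrow> real) \<Rightarrow> (real \<Rightarrow> real \<Rightarrow> real) \<Rightarrow> (real \<Rightarrow> real \<Rightarrow> real)
     \<Rightarrow> nat \<Rightarrow> nat \<Rightarrow> real" where
  "dg_form M g g' \<phi> i j =
     integral (cellI M i j) (\<lambda>(x, v). g' x v * \<phi> x v)
   - integral (cellI M i j) (\<lambda>(x, v). v * g x v * deriv (\<lambda>y. \<phi> y v) x)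
   + integral (cellK M j) (\<lambda>v. flux_x M g i j v * trace_x_minus \<phi> (xn M i) v)
   - integral (cellK M j) (\<lambda>v. flux_x M g (i - 1) j v * trace_x_plus \<phi> (xn M (i - 1)) v)
   + integral (cellI M i j) (\<lambda>(x, v). efield M g x * g x v * deriv (\<phi> x) v)
   - integral (cellJ M i) (\<lambda>x. flux_v M g i j x * trace_v_minus \<phi> x (vn M j))
   + integral (cellJ M i) (\<lambda>x. flux_v M g i (j - 1) x * trace_v_plus \<phi> x (vn M (j - 1)))"

definition semidiscrete_solution ::
  "dg_mesh \<Rightarrow> (real \<Rightarrow> real \<Rightarrow> real) set \<Rightarrow> real \<Rightarrow> (real \<Rightarrow> real \<Rightarrow> real \<Rightarrow> real) \<Rightarrow> bool" where
  "semidiscrete_solution M S T fh \<longleftrightarrow>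
     (\<forall>t\<in>{0..T}.
        fh t \<in> S \<and>
        (\<forall>x v. fh t (x + len M) v = fh t x v) \<and>
        (\<forall>i\<in>{1..Nx M}. \<forall>j\<in>{1..Nv M}. \<forall>x\<in>interior (cellJ M i). \<forall>v\<in>interior (cellK M j).
           (\<lambda>s. fh s x v) differentiable (at t within {0..T})) \<and>
        (\<forall>\<phi>\<in>S. \<forall>i\<in>{1..Nx M}. \<forall>j\<in>{1..Nv M}. dg_form M (fh t) (time_deriv T fh t) \<phi> i j = 0))"

text \<open>\<open>f(x,\<plusminus>V\<^sub>c) = 0\<close>, for both the interior and the exterior trace.\<close>

definition vanishes_at_vmax :: "dg_mesh \<Rightarrow> (real \<Rightarrow> real \<Rightarrow> real) \<Rightarrow> bool" where
  "vanishes_at_vmax M g \<longleftrightarrow>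
     (\<forall>i\<in>{1..Nx M}. \<forall>x\<in>interior (cellJ M i). \<forall>b\<in>{- vmax M, vmax M}.
        (g x \<longlongrightarrow> 0) (at_left b) \<and> (g x \<longlongrightarrow> 0) (at_right b))"

text \<open>Classical solution of the continuous system, periodic in \<open>x\<close>; the Poisson equation
  \<open>-\<Phi>\<^sub>x\<^sub>x = 1 - \<integral>f dv\<close> is written as the pair \<open>\<Phi>\<^sub>x = -E\<close>, \<open>E\<^sub>x = 1 - \<integral>f dv\<close>.\<close>

definition vlasov_poisson_solution ::
  "real \<Rightarrow> real \<Rightarrow> (real \<Rightarrow> real \<Rightarrow> real \<Rightarrow> real) \<Rightarrow> (real \<Rightarrow> real \<Rightarrow> real) \<Rightarrow> (real \<Rightarrow> real \<Rightarrow> real)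
     \<Rightarrow> bool" where
  "vlasov_poisson_solution L T f \<Phi> E \<longleftrightarrow>
     continuous_on ({0..T} \<times> UNIV) (\<lambda>(t, x, v). f t x v) \<and>
     (\<exists>ft fx fv.
        continuous_on ({0..T} \<times> UNIV) (\<lambda>(t, x, v). ft t x v) \<and>
        continuous_on ({0..T} \<times> UNIV) (\<lambda>(t, x, v). fx t x v) \<and>
        continuous_on ({0..T} \<times> UNIV) (\<lambda>(t, x, v). fv t x v) \<and>
        (\<forall>t\<in>{0..T}. \<forall>x v.
           ((\<lambda>s. f s x v) has_real_derivative ft t x v) (at t within {0..T}) \<and>
           ((\<lambda>y. f t y v) has_real_derivative fx t x v) (at x) \<and>
           (f t x has_real_derivative fv t x v) (at v) \<and>
           ft t x v + v * fx t x v - E t x * fv t x v = 0)) \<and>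
     (\<forall>t\<in>{0..T}. \<forall>x.
        (\<Phi> t has_real_derivative - E t x) (at x) \<and>
        (E t has_real_derivative 1 - integral UNIV (f t x)) (at x)) \<and>
     (\<forall>t\<in>{0..T}. \<forall>x. \<Phi> t (x + L) = \<Phi> t x \<and> (\<forall>v. f t (x + L) v = f t x v))"

definition energy :: "dg_mesh \<Rightarrow> (real \<Rightarrow> real \<Rightarrow> real) \<Rightarrow> real" where
  "energy M g =
     1 / 2 * (\<Sum>i=1..Nx M. \<Sum>j=1..Nv M. integral (cellI M i j) (\<lambda>(x, v). g x v * v\<^sup>2))
   + 1 / 2 * (\<Sum>i=1..Nx M. integral (cellJ M i) (\<lambda>x. (efield M g x)\<^sup>2))"

text \<open>The operator \<open>A(w,u)\<close> at time \<open>t\<close>. Since it involves \<open>w\<^sub>t\<close>, the first argument is a function of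
  time as well, while \<open>u\<close> is the second argument frozen at time \<open>t\<close>.\<close>

definition A_op ::
  "dg_mesh \<Rightarrow> real \<Rightarrow> real \<Rightarrow> (real \<Rightarrow> real \<Rightarrow> real \<Rightarrow> real) \<Rightarrow> (real \<Rightarrow> real) \<Rightarrow> real" where
  "A_op M T t w u = (\<Sum>i=1..Nx M. \<Sum>j=1..Nv M.
     integral (cellI M i j) (\<lambda>(x, v). w t x v * deriv u x * v - time_deriv T w t x v * u x))"

definition projection_on :: "(real \<Rightarrow> real) set \<Rightarrow> ((real \<Rightarrow> real) \<Rightarrow> real \<Rightarrow> real) \<Rightarrow> bool" where
  "projection_on D P \<longleftrightarrow> (\<forall>u\<in>D. P u \<in> D \<and> P (P u) = P u)"

text \<open>Agreement of \<open>w\<close> (in general discontinuous) with the continuous function \<open>u\<close> at all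
  \<open>x\<^sub>i\<^sub>+\<^sub>1\<^sub>/\<^sub>2\<close>: every trace of \<open>w\<close> taken from inside \<open>[0,L]\<close> equals the nodal value of \<open>u\<close>.\<close>

definition agrees_at_nodes :: "dg_mesh \<Rightarrow> (real \<Rightarrow> real) \<Rightarrow> (real \<Rightarrow> real) \<Rightarrow> bool" where
  "agrees_at_nodes M w u \<longleftrightarrow>
     (\<forall>i\<in>{0..Nx M}. (0 < i \<longrightarrow> (w \<longlongrightarrow> u (xn M i)) (at_left (xn M i))) \<and>
                    (i < Nx M \<longrightarrow> (w \<longlongrightarrow> u (xn M i)) (at_right (xn M i))))"

end

theory Submission
  imports Defs
begin

text \<open>
  Fix a time and write \<open>g = f\<^sub>h\<close>, \<open>g' = (f\<^sub>h)\<^sub>t\<close>, \<open>\<rho>'\<close> for the velocity integral of \<open>g'\<close>, \<open>E = E\<^sub>h\<close> and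
  \<open>\<Phi> = \<Phi>\<^sub>h\<close>. The energy changes at the rate \<open>\<integral>\<integral> g' v\<^sup>2 / 2 + \<integral> E E\<^sub>t\<close>.

  Kinetic part. The function \<open>v\<^sup>2 / 2\<close> is an admissible test function and is continuous across all
  interfaces, so summing the scheme over the cells cancels every numerical flux: in the interior in
  pairs, at \<open>x = 0, L\<close> by periodicity, at \<open>v = \<plusminus>V\<^sub>c\<close> by the boundary condition. What is left is
  \<open>\<integral>\<integral> g' v\<^sup>2 / 2 = - \<integral>\<integral> E g v\<close> (\<open>kinetic_energy_balance\<close>).

  Field part. \<open>E\<^sub>t\<close> has the \<open>x\<close>-derivative \<open>- \<rho>'\<close>, \<open>\<Phi>\<close> has the derivative \<open>- E\<close> and vanishes at \<open>0\<close> and \<open>L\<close>.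
  Integration by parts gives \<open>\<integral> E E\<^sub>t = - \<integral> \<rho>' \<Phi>\<close> (\<open>integral_efield_self_field\<close>). As \<open>\<Phi>\<^sub>x = - E\<close>, the two parts
  add up to \<open>A (f\<^sub>h, \<Phi>)\<close>.

  Second identity. \<open>A\<close> is bilinear, so it suffices that \<open>A (f\<^sub>h, P \<Phi>) = 0\<close> and \<open>A (f, \<Phi> - P \<Phi>) = 0\<close>. The former is the
  scheme tested with \<open>P \<Phi>\<close>: it depends on \<open>x\<close> only, and its traces at the nodes are the values of the
  continuous periodic function \<open>\<Phi>\<close>, so that the fluxes cancel again (\<open>x_test_function_balance\<close>). For
  the latter, \<open>\<Phi> - P \<Phi>\<close> has zero traces at every node; integrating the Vlasov equation against it over
  each cell leaves no boundary terms in \<open>x\<close>, and those in \<open>v\<close> telescope to \<open>v = \<plusminus>V\<^sub>c\<close>, where \<open>f = 0\<close>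
  (\<open>A_form_exact_solution\<close>).

  Differentiability of the energy. The solution is only known to be differentiable in time at each
  point of the open cells. On a cell, however, a polynomial of given degree is a combination of its
  values at fixed interpolation nodes, with coefficients that do not depend on time. The energy is
  therefore a quadratic polynomial in finitely many differentiable functions of time
  (\<open>V_space_nodal_basis\<close>, \<open>energy_has_derivative\<close>).
\<close>

section \<open>Piecewise continuous functions on a partition\<close>

lemma has_integral_partition:
  fixes p :: "nat \<Rightarrow> real" and h :: "real \<Rightarrow> real"
  assumes "strict_mono_on {0..n} p"
    and "\<And>i. i \<in> {1..n} \<Longrightarrow> (h has_integral y i) {p (i - 1)..p i}"
  shows "(h has_integral (\<Sum>i=1..n. y i)) {p 0..p n}"
  using assms
proof (induction n)
  case 0
  then show ?case by (simp add: has_integral_refl(2))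
next
  case (Suc n)
  have "(h has_integral (\<Sum>i=1..n. y i)) {p 0..p n}"
    using Suc.prems by (intro Suc.IH) (auto intro: monotone_on_subset)
  moreover have "(h has_integral y (Suc n)) {p n..p (Suc n)}"
    using Suc.prems(2)[of "Suc n"] by simp
  moreover have "p 0 \<le> p n" "p n \<le> p (Suc n)"
    using strict_mono_on_leD[OF Suc.prems(1)] by auto
  ultimately have "(h has_integral (\<Sum>i=1..n. y i) + y (Suc n)) {p 0..p (Suc n)}"
    by (intro has_integral_combine)
  then show ?case by simp
qed

lemma has_integral_open_interval_eq:
  fixes r q :: "real \<Rightarrow> real"
  assumes "continuous_on {a..b} q" "\<And>x. x \<in> {a<..<b} \<Longrightarrow> r x = q x"
  shows "(r has_integral integral {a..b} q) {a..b}"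
proof -
  have "(q has_integral integral {a..b} q) (cbox a b)"
    using assms(1) by (simp add: integrable_continuous_real integrable_integral)
  then have "(r has_integral integral {a..b} q) (cbox a b)"
    by (rule has_integral_spike_interior) (use assms(2) in auto)
  then show ?thesis by simp
qed

lemma has_integral_open_rectangle_eq:
  fixes g G :: "real \<Rightarrow> real \<Rightarrow> real"
  assumes G: "continuous_on ({a..b} \<times> {c..d}) (\<lambda>(x, v). G x v)"
    and eq: "\<And>x v. x \<in> {a<..<b} \<Longrightarrow> v \<in> {c<..<d} \<Longrightarrow> g x v = G x v"
  shows "((\<lambda>(x, v). g x v) has_integral integral {a..b} (\<lambda>x. integral {c..d} (G x)))
           ({a..b} \<times> {c..d})"
proof -
  have box: "{a..b} \<times> {c..d} = cbox (a, c) (b, d)"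
    by (simp add: cbox_Pair_eq)
  have G': "continuous_on (cbox (a, c) (b, d)) (\<lambda>(x, v). G x v)"
    using G by (simp add: box)
  have "((\<lambda>(x, v). G x v) has_integral integral (cbox (a, c) (b, d)) (\<lambda>(x, v). G x v))
          (cbox (a, c) (b, d))"
    using G' by (simp add: integrable_continuous integrable_integral)
  then have "((\<lambda>(x, v). g x v) has_integral integral (cbox (a, c) (b, d)) (\<lambda>(x, v). G x v))
          (cbox (a, c) (b, d))"
    by (rule has_integral_spike_interior)
       (use eq in \<open>auto simp: box_def Basis_prod_def\<close>)
  also have "integral (cbox (a, c) (b, d)) (\<lambda>(x, v). G x v)
      = integral {a..b} (\<lambda>x. integral {c..d} (G x))"
    using integral_prod_continuous[OF G'] by simp
  finally show ?thesis by (simp add: box)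
qed

text \<open>
  Broken functions of one variable. Continuity inside the subintervals would not bound the function
  near the partition points, so an extension to each closed subinterval is demanded; the values at
  the partition points themselves carry no information.
\<close>

definition piecewise_continuous :: "(nat \<Rightarrow> real) \<Rightarrow> nat \<Rightarrow> (real \<Rightarrow> real) \<Rightarrow> bool" where
  "piecewise_continuous p n r \<longleftrightarrow> (\<forall>i\<in>{1..n}. \<exists>q. continuous_on {p (i - 1)..p i} q \<and>
     (\<forall>x\<in>{p (i - 1)<..<p i}. r x = q x))"

lemma continuous_imp_piecewise_continuous:
  assumes "strict_mono_on {0..n} p" "continuous_on {p 0..p n} r"
  shows "piecewise_continuous p n r"
  unfolding piecewise_continuous_def
proof
  fix i assume i: "i \<in> {1..n}"
  have "p 0 \<le> p (i - 1)" "p i \<le> p n"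
    using strict_mono_on_leD[OF assms(1)] i by auto
  then have "continuous_on {p (i - 1)..p i} r"
    by (intro continuous_on_subset[OF assms(2)]) auto
  then show "\<exists>q. continuous_on {p (i - 1)..p i} q \<and> (\<forall>x\<in>{p (i - 1)<..<p i}. r x = q x)"
    by blast
qed

lemma piecewise_continuous_has_integral:
  assumes p: "strict_mono_on {0..n} p" and r: "piecewise_continuous p n r"
  shows "(r has_integral (\<Sum>i=1..n. integral {p (i - 1)..p i} r)) {p 0..p n}"
proof (rule has_integral_partition[OF p])
  fix i assume "i \<in> {1..n}"
  then obtain q where "continuous_on {p (i - 1)..p i} q" "\<forall>x\<in>{p (i - 1)<..<p i}. r x = q x"
    using r unfolding piecewise_continuous_def by blast
  then have "r integrable_on {p (i - 1)..p i}"
    using has_integral_open_interval_eq[of _ _ q r] by blast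
  then show "(r has_integral integral {p (i - 1)..p i} r) {p (i - 1)..p i}"
    by (rule integrable_integral)
qed

lemma piecewise_continuous_integrable:
  assumes "strict_mono_on {0..n} p" "piecewise_continuous p n r"
  shows "r integrable_on {p 0..p n}"
  using piecewise_continuous_has_integral[OF assms] by blast

lemma piecewise_continuous_isCont:
  assumes "piecewise_continuous p n r" "i \<in> {1..n}" "x \<in> {p (i - 1)<..<p i}"
  shows "isCont r x"
proof -
  obtain q where q: "continuous_on {p (i - 1)..p i} q" "\<forall>x\<in>{p (i - 1)<..<p i}. r x = q x"
    using assms unfolding piecewise_continuous_def by blast
  have "continuous_on {p (i - 1)<..<p i} r"
    by (rule continuous_on_eq[OF continuous_on_subset[OF q(1)]]) (use q(2) in auto)
  then show ?thesis
    using assms(3) by (simp add: continuous_on_eq_continuous_at)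
qed

text \<open>
  The primitive of a broken function is differentiable off the partition points. This gives the
  derivative of the electric field, which jumps with the charge density at the nodes.
\<close>

lemma piecewise_continuous_integral_has_derivative:
  assumes p: "strict_mono_on {0..n} p" and r: "piecewise_continuous p n r"
    and i: "i \<in> {1..n}" and x: "x \<in> {p (i - 1)<..<p i}"
  shows "((\<lambda>y. integral {p 0..y} r) has_real_derivative r x) (at x)"
proof -
  have "p 0 \<le> p (i - 1)" "p i \<le> p n"
    using strict_mono_on_leD[OF p] i by auto
  then have xin: "x \<in> {p 0<..<p n}" using x by auto
  have "continuous (at x within {p 0..p n} - {}) r"
    using piecewise_continuous_isCont[OF r i x] by (simp add: continuous_at_imp_continuous_within)
  then have "((\<lambda>u. integral {p 0..u} r) has_vector_derivative r x) (at x within ({p 0..p n} - {}))"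
    using piecewise_continuous_integrable[OF p r] xin
    by (intro integral_has_vector_derivative_continuous_at) auto
  moreover have "at x within ({p 0..p n} - {}) = at x"
    using xin by (simp add: at_within_Icc_at)
  ultimately show ?thesis
    by (simp add: has_real_derivative_iff_has_vector_derivative)
qed

lemma partition_cases:
  fixes p :: "nat \<Rightarrow> real"
  assumes "x \<in> {p 0..p n}" "x \<notin> p ` {0..n}"
  shows "\<exists>i\<in>{1..n}. x \<in> {p (i - 1)<..<p i}"
  using assms
proof (induction n)
  case 0
  then show ?case by auto
next
  case (Suc n)
  show ?case
  proof (cases "x \<le> p n")
    case True
    then have "\<exists>i\<in>{1..n}. x \<in> {p (i - 1)<..<p i}"
      using Suc.prems by (intro Suc.IH) auto
    then show ?thesis by force
  next
    case False
    then have "x \<in> {p (Suc n - 1)<..<p (Suc n)}"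
      using Suc.prems by force
    then show ?thesis by (intro bexI[of _ "Suc n"]) auto
  qed
qed

lemma open_cells_disjoint:
  fixes p :: "nat \<Rightarrow> real"
  assumes p: "strict_mono_on {0..n} p" and "i \<in> {1..n}" "i' \<in> {1..n}"
    and "x \<in> {p (i - 1)<..<p i}" "x \<in> {p (i' - 1)<..<p i'}"
  shows "i = i'"
proof (rule ccontr)
  assume "i \<noteq> i'"
  then consider "i \<le> i' - 1" | "i' \<le> i - 1" by linarith
  then show False
  proof cases
    case 1
    then have "p i \<le> p (i' - 1)"
      using strict_mono_on_leD[OF p, of i "i' - 1"] assms(2,3) by auto
    then show False using assms(4,5) by simp
  next
    case 2
    then have "p i' \<le> p (i - 1)"
      using strict_mono_on_leD[OF p, of i' "i - 1"] assms(2,3) by auto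
    then show False using assms(4,5) by simp
  qed
qed

section \<open>Functions continuous up to the boundary of each mesh cell\<close>

lemma interior_cellJ: "interior (cellJ M i) = {xn M (i - 1)<..<xn M i}"
  and interior_cellK: "interior (cellK M j) = {vn M (j - 1)<..<vn M j}"
  by (simp_all add: cellJ_def cellK_def)

lemma cell_has_integral:
  fixes g G :: "real \<Rightarrow> real \<Rightarrow> real"
  assumes "continuous_on (cellI M i j) (\<lambda>(x, v). G x v)"
    and "\<And>x v. x \<in> interior (cellJ M i) \<Longrightarrow> v \<in> interior (cellK M j) \<Longrightarrow> g x v = G x v"
  shows "((\<lambda>(x, v). g x v) has_integral
           integral (cellJ M i) (\<lambda>x. integral (cellK M j) (G x))) (cellI M i j)"
  using assms has_integral_open_rectangle_eq[of "xn M (i - 1)" "xn M i" "vn M (j - 1)" "vn M j" G g]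
  by (simp add: cellI_def cellJ_def cellK_def)

lemma has_integral_cell_spike:
  fixes h H :: "real \<Rightarrow> real \<Rightarrow> real"
  assumes "((\<lambda>(x, v). H x v) has_integral y) (cellI M i j)"
    and "\<And>x v. x \<in> interior (cellJ M i) \<Longrightarrow> v \<in> interior (cellK M j) \<Longrightarrow> h x v = H x v"
  shows "((\<lambda>(x, v). h x v) has_integral y) (cellI M i j)"
proof -
  have box: "cellI M i j = cbox (xn M (i - 1), vn M (j - 1)) (xn M i, vn M j)"
    by (simp add: cellI_def cellJ_def cellK_def cbox_Pair_eq)
  show ?thesis
    using assms(1) unfolding box
    by (rule has_integral_spike_interior)
       (use assms(2) in \<open>auto simp: box_def Basis_prod_def interior_cellJ interior_cellK\<close>)
qed

text \<open>
  The phase space functions whose integrals appear below. Values on the interfaces are arbitrary and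
  the extension to a closed cell depends on the cell, since one-sided traces differ; both the members of the discrete spaces and their pointwise time derivatives belong to it.
\<close>

definition cellwise_continuous :: "dg_mesh \<Rightarrow> (real \<Rightarrow> real \<Rightarrow> real) \<Rightarrow> bool" where
  "cellwise_continuous M g \<longleftrightarrow> (\<forall>i\<in>{1..Nx M}. \<forall>j\<in>{1..Nv M}. \<exists>G.
     continuous_on (cellI M i j) (\<lambda>(x, v). G x v) \<and>
     (\<forall>x\<in>interior (cellJ M i). \<forall>v\<in>interior (cellK M j). g x v = G x v))"

lemma cellwise_continuousE:
  assumes "cellwise_continuous M g" "i \<in> {1..Nx M}" "j \<in> {1..Nv M}"
  obtains G where "continuous_on (cellI M i j) (\<lambda>(x, v). G x v)"
    "\<And>x v. x \<in> interior (cellJ M i) \<Longrightarrow> v \<in> interior (cellK M j) \<Longrightarrow> g x v = G x v"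
  using assms unfolding cellwise_continuous_def by blast

lemma cellwise_continuous_times_integrable:
  assumes "cellwise_continuous M g" "i \<in> {1..Nx M}" "j \<in> {1..Nv M}"
    and w: "continuous_on (cellI M i j) (\<lambda>(x, v). w x v)"
  shows "(\<lambda>(x, v). g x v * w x v) integrable_on cellI M i j"
proof -
  obtain G where G: "continuous_on (cellI M i j) (\<lambda>(x, v). G x v)"
    "\<And>x v. x \<in> interior (cellJ M i) \<Longrightarrow> v \<in> interior (cellK M j) \<Longrightarrow> g x v = G x v"
    using cellwise_continuousE[OF assms(1-3)] by metis
  have "continuous_on (cellI M i j) (\<lambda>(x, v). G x v * w x v)"
    using continuous_on_mult[OF G(1) w] by (simp add: case_prod_beta)
  then have "((\<lambda>(x, v). g x v * w x v) has_integral
      integral (cellJ M i) (\<lambda>x. integral (cellK M j) (\<lambda>v. G x v * w x v))) (cellI M i j)"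
    by (rule cell_has_integral) (simp add: G(2))
  then show ?thesis by blast
qed

lemma continuous_on_snd_section:
  assumes G: "continuous_on (A \<times> B) (\<lambda>(x, v). G x v)" and "x \<in> A"
  shows "continuous_on B (G x)"
proof -
  have "continuous_on B (\<lambda>v. case (x, v) of (x, v) \<Rightarrow> G x v)"
    using assms(2) by (intro continuous_on_compose2[OF G]) (auto intro!: continuous_intros)
  then show ?thesis by simp
qed

lemma continuous_on_fst_section:
  assumes G: "continuous_on (A \<times> B) (\<lambda>(x, v). G x v)" and "v \<in> B"
  shows "continuous_on A (\<lambda>x. G x v)"
proof -
  have "continuous_on A (\<lambda>x. case (x, v) of (x, v) \<Rightarrow> G x v)"
    using assms(2) by (intro continuous_on_compose2[OF G]) (auto intro!: continuous_intros)
  then show ?thesis by simp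
qed

context
  fixes M :: dg_mesh
  assumes mesh: "valid_mesh M"
begin

lemma xn_mono: "strict_mono_on {0..Nx M} (xn M)"
  and vn_mono: "strict_mono_on {0..Nv M} (vn M)"
  and xn_0: "xn M 0 = 0" and xn_Nx: "xn M (Nx M) = len M"
  and vn_0: "vn M 0 = - vmax M" and vn_Nv: "vn M (Nv M) = vmax M"
  using mesh by (simp_all add: valid_mesh_def)

lemma xn_step: "i \<in> {1..Nx M} \<Longrightarrow> xn M (i - 1) < xn M i"
  using strict_mono_onD[OF xn_mono, of "i - 1" i] by auto

lemma vn_step: "j \<in> {1..Nv M} \<Longrightarrow> vn M (j - 1) < vn M j"
  using strict_mono_onD[OF vn_mono, of "j - 1" j] by auto

lemma xn_bounds: "i \<le> Nx M \<Longrightarrow> 0 \<le> xn M i \<and> xn M i \<le> len M"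
  using strict_mono_on_leD[OF xn_mono, of 0 i] strict_mono_on_leD[OF xn_mono, of i "Nx M"]
  by (simp add: xn_0 xn_Nx)

lemma len_pos: "0 < len M"
  using strict_mono_onD[OF xn_mono, of 0 "Nx M"] mesh by (simp add: xn_0 xn_Nx valid_mesh_def)

lemma cellJ_subset: "i \<in> {1..Nx M} \<Longrightarrow> cellJ M i \<subseteq> {0..len M}"
  using xn_bounds[of i] xn_bounds[of "i - 1"] by (auto simp: cellJ_def)

lemma interior_cellJ_subset: "i \<in> {1..Nx M} \<Longrightarrow> interior (cellJ M i) \<subseteq> {0<..<len M}"
  using xn_bounds[of i] xn_bounds[of "i - 1"] by (force simp: interior_cellJ)

lemma off_nodes_in_open_cell:
  assumes "x \<in> {0..len M}" "x \<notin> xn M ` {0..Nx M}"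
  obtains i where "i \<in> {1..Nx M}" "x \<in> interior (cellJ M i)"
  using partition_cases[of x "xn M" "Nx M"] assms
  by (metis interior_cellJ xn_0 xn_Nx)

lemma off_nodes_in_open_cell_v:
  assumes "v \<in> {-vmax M..vmax M}" "v \<notin> vn M ` {0..Nv M}"
  obtains j where "j \<in> {1..Nv M}" "v \<in> interior (cellK M j)"
  using partition_cases[of v "vn M" "Nv M"] assms
  by (metis interior_cellK vn_0 vn_Nv)

lemma sum_cellJ_integral:
  fixes r :: "real \<Rightarrow> real"
  assumes "continuous_on {0..len M} r"
  shows "(\<Sum>i=1..Nx M. integral (cellJ M i) r) = integral {0..len M} r"
  using piecewise_continuous_has_integral[OF xn_mono continuous_imp_piecewise_continuous[OF xn_mono],
      of r] assms
  by (simp add: xn_0 xn_Nx cellJ_def integral_unique)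

section \<open>Charge density, electric field and potential\<close>

lemma charge_density_has_integral:
  fixes g :: "real \<Rightarrow> real \<Rightarrow> real"
  assumes i: "i \<in> {1..Nx M}" and x: "x \<in> interior (cellJ M i)"
    and G: "\<And>j. j \<in> {1..Nv M} \<Longrightarrow> continuous_on (cellI M i j) (\<lambda>(x, v). G j x v)"
    and eq: "\<And>j x v. j \<in> {1..Nv M} \<Longrightarrow> x \<in> interior (cellJ M i) \<Longrightarrow> v \<in> interior (cellK M j) \<Longrightarrow>
         g x v = G j x v"
  shows "(g x has_integral (\<Sum>j=1..Nv M. integral (cellK M j) (G j x))) {-vmax M..vmax M}"
proof -
  have "(g x has_integral (\<Sum>j=1..Nv M. integral (cellK M j) (G j x))) {vn M 0..vn M (Nv M)}"
  proof (rule has_integral_partition[OF vn_mono])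
    fix j assume j: "j \<in> {1..Nv M}"
    have "x \<in> cellJ M i" using x interior_subset by blast
    then have "continuous_on (cellK M j) (G j x)"
      using G[OF j] unfolding cellI_def by (rule continuous_on_snd_section[rotated])
    then have "continuous_on {vn M (j - 1)..vn M j} (G j x)"
      by (simp add: cellK_def)
    moreover have "g x v = G j x v" if "v \<in> {vn M (j - 1)<..<vn M j}" for v
      using eq[OF j x] that by (simp add: interior_cellK)
    ultimately show "(g x has_integral integral (cellK M j) (G j x)) {vn M (j - 1)..vn M j}"
      unfolding cellK_def by (rule has_integral_open_interval_eq)
  qed
  then show ?thesis by (simp add: vn_0 vn_Nv)
qed

lemma cellwise_continuous_extension:
  assumes g: "cellwise_continuous M g" and i: "i \<in> {1..Nx M}"
  obtains G where "\<And>j. j \<in> {1..Nv M} \<Longrightarrow> continuous_on (cellI M i j) (\<lambda>(x, v). G j x v)"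
    and "\<And>j x v. j \<in> {1..Nv M} \<Longrightarrow> x \<in> interior (cellJ M i) \<Longrightarrow> v \<in> interior (cellK M j) \<Longrightarrow>
         g x v = G j x v"
proof -
  have "\<forall>j\<in>{1..Nv M}. \<exists>G. continuous_on (cellI M i j) (\<lambda>(x, v). G x v) \<and>
     (\<forall>x\<in>interior (cellJ M i). \<forall>v\<in>interior (cellK M j). g x v = G x v)"
    using g i unfolding cellwise_continuous_def by blast
  then obtain G where "\<forall>j\<in>{1..Nv M}. continuous_on (cellI M i j) (\<lambda>(x, v). G j x v) \<and>
     (\<forall>x\<in>interior (cellJ M i). \<forall>v\<in>interior (cellK M j). g x v = G j x v)"
    by metis
  then show ?thesis using that by blast
qed

lemma cellwise_continuous_section_integrable:
  assumes "cellwise_continuous M g" "i \<in> {1..Nx M}" "x \<in> interior (cellJ M i)"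
  shows "g x integrable_on {-vmax M..vmax M}"
proof -
  obtain G where "\<And>j. j \<in> {1..Nv M} \<Longrightarrow> continuous_on (cellI M i j) (\<lambda>(x, v). G j x v)"
    and "\<And>j x v. j \<in> {1..Nv M} \<Longrightarrow> x \<in> interior (cellJ M i) \<Longrightarrow> v \<in> interior (cellK M j) \<Longrightarrow>
         g x v = G j x v"
    using cellwise_continuous_extension[OF assms(1,2)] by metis
  from charge_density_has_integral[OF assms(2,3) this] show ?thesis by blast
qed

lemma continuous_on_integral_cellK:
  fixes G :: "real \<Rightarrow> real \<Rightarrow> real"
  assumes "continuous_on (cellI M i j) (\<lambda>(x, v). G x v)"
  shows "continuous_on (cellJ M i) (\<lambda>x. integral (cellK M j) (G x))"
  using integral_continuous_on_param[of "cellJ M i" "vn M (j - 1)" "vn M j" G] assms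
  by (simp add: cellI_def cellK_def)

lemma charge_density_piecewise_continuous:
  assumes g: "cellwise_continuous M g"
  shows "piecewise_continuous (xn M) (Nx M) (charge_density M g)"
  unfolding piecewise_continuous_def
proof
  fix i assume i: "i \<in> {1..Nx M}"
  obtain G where G: "\<And>j. j \<in> {1..Nv M} \<Longrightarrow> continuous_on (cellI M i j) (\<lambda>(x, v). G j x v)"
    and eq: "\<And>j x v. j \<in> {1..Nv M} \<Longrightarrow> x \<in> interior (cellJ M i) \<Longrightarrow> v \<in> interior (cellK M j) \<Longrightarrow>
         g x v = G j x v"
    using cellwise_continuous_extension[OF g i] by metis
  have "continuous_on (cellJ M i) (\<lambda>x. \<Sum>j=1..Nv M. integral (cellK M j) (G j x))"
    by (intro continuous_on_sum continuous_on_integral_cellK G)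
  moreover have "charge_density M g x = (\<Sum>j=1..Nv M. integral (cellK M j) (G j x))"
    if "x \<in> interior (cellJ M i)" for x
    using charge_density_has_integral[OF i that G eq] unfolding charge_density_def
    by (simp add: integral_unique)
  ultimately show "\<exists>q. continuous_on {xn M (i - 1)..xn M i} q \<and>
      (\<forall>x\<in>{xn M (i - 1)<..<xn M i}. charge_density M g x = q x)"
    unfolding interior_cellJ unfolding cellJ_def by blast
qed

text \<open>
  A weight that depends on \<open>x\<close> alone sees only the velocity average: Fubini on each cell. It turns
  the phase space integral of \<open>(f\<^sub>h)\<^sub>t \<Phi>\<^sub>h\<close> into a one-dimensional one that can be integrated by parts.
\<close>

lemma sum_cell_integral_eq_charge_density:
  assumes g: "cellwise_continuous M g" and r: "continuous_on {0..len M} r"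
  shows "(\<Sum>i=1..Nx M. \<Sum>j=1..Nv M. integral (cellI M i j) (\<lambda>(x, v). g x v * r x))
       = integral {0..len M} (\<lambda>x. charge_density M g x * r x)"
proof -
  have "((\<lambda>x. charge_density M g x * r x) has_integral
     (\<Sum>i=1..Nx M. \<Sum>j=1..Nv M. integral (cellI M i j) (\<lambda>(x, v). g x v * r x)))
     {xn M 0..xn M (Nx M)}"
  proof (rule has_integral_partition[OF xn_mono])
    fix i assume i: "i \<in> {1..Nx M}"
    obtain G where G: "\<And>j. j \<in> {1..Nv M} \<Longrightarrow> continuous_on (cellI M i j) (\<lambda>(x, v). G j x v)"
      and eq: "\<And>j x v. j \<in> {1..Nv M} \<Longrightarrow> x \<in> interior (cellJ M i) \<Longrightarrow>
           v \<in> interior (cellK M j) \<Longrightarrow> g x v = G j x v"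
      using cellwise_continuous_extension[OF g i] by metis
    have rJ: "continuous_on (cellJ M i) r"
      using r cellJ_subset[OF i] continuous_on_subset by blast
    have Gr: "continuous_on (cellI M i j) (\<lambda>(x, v). G j x v * r x)" if "j \<in> {1..Nv M}" for j
    proof -
      have "continuous_on (cellI M i j) (\<lambda>p. r (fst p))"
        by (rule continuous_on_compose2[OF rJ]) (auto simp: cellI_def intro!: continuous_intros)
      from continuous_on_mult[OF G[OF that] this] show ?thesis
        by (simp add: case_prod_beta)
    qed
    have cell: "integral (cellI M i j) (\<lambda>(x, v). g x v * r x)
        = integral (cellJ M i) (\<lambda>x. integral (cellK M j) (G j x) * r x)" if j: "j \<in> {1..Nv M}" for j
      using cell_has_integral[OF Gr[OF j], of "\<lambda>x v. g x v * r x"] eq[OF j]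
      by (simp add: integral_unique)
    have cts: "continuous_on (cellJ M i) (\<lambda>x. integral (cellK M j) (G j x) * r x)"
      if "j \<in> {1..Nv M}" for j
      using continuous_on_integral_cellK[OF G[OF that]] rJ by (intro continuous_on_mult)
    have "(\<Sum>j=1..Nv M. integral (cellI M i j) (\<lambda>(x, v). g x v * r x))
        = (\<Sum>j=1..Nv M. integral (cellJ M i) (\<lambda>x. integral (cellK M j) (G j x) * r x))"
      by (intro sum.cong refl cell)
    also have "\<dots> = integral (cellJ M i) (\<lambda>x. \<Sum>j=1..Nv M. integral (cellK M j) (G j x) * r x)"
      using cts by (intro integral_sum[symmetric])
        (auto simp: cellJ_def intro!: integrable_continuous_real)
    finally have sum: "(\<Sum>j=1..Nv M. integral (cellI M i j) (\<lambda>(x, v). g x v * r x))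
        = integral (cellJ M i) (\<lambda>x. \<Sum>j=1..Nv M. integral (cellK M j) (G j x) * r x)" .
    have "charge_density M g x * r x = (\<Sum>j=1..Nv M. integral (cellK M j) (G j x) * r x)"
      if "x \<in> interior (cellJ M i)" for x
      using charge_density_has_integral[OF i that G eq] unfolding charge_density_def
      by (simp add: integral_unique sum_distrib_right)
    moreover have "continuous_on (cellJ M i)
        (\<lambda>x. \<Sum>j=1..Nv M. integral (cellK M j) (G j x) * r x)"
      by (intro continuous_on_sum cts)
    ultimately show "((\<lambda>x. charge_density M g x * r x) has_integral
       (\<Sum>j=1..Nv M. integral (cellI M i j) (\<lambda>(x, v). g x v * r x))) {xn M (i - 1)..xn M i}"
      unfolding sum interior_cellJ unfolding cellJ_def by (intro has_integral_open_interval_eq)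
  qed
  then show ?thesis by (simp add: xn_0 xn_Nx integral_unique)
qed

text \<open>
  Linearity holds on the open cells only: at a node \<open>x\<close> the section of a function in the class need not
  be integrable.
\<close>

lemma charge_density_linear:
  assumes fin: "finite I" and b: "\<And>k. k \<in> I \<Longrightarrow> cellwise_continuous M (b k)"
    and i: "i \<in> {1..Nx M}" and x: "x \<in> interior (cellJ M i)"
    and g: "\<And>j v. j \<in> {1..Nv M} \<Longrightarrow> v \<in> interior (cellK M j) \<Longrightarrow>
        g x v = (\<Sum>k\<in>I. c k * b k x v)"
  shows "charge_density M g x = (\<Sum>k\<in>I. c k * charge_density M (b k) x)"
proof -
  have "((\<lambda>v. \<Sum>k\<in>I. c k * b k x v) has_integral (\<Sum>k\<in>I. c k * charge_density M (b k) x))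
      {-vmax M..vmax M}"
    unfolding charge_density_def
    by (intro has_integral_sum fin has_integral_mult_right integrable_integral
        cellwise_continuous_section_integrable[OF b i x])
  then have "(g x has_integral (\<Sum>k\<in>I. c k * charge_density M (b k) x)) {-vmax M..vmax M}"
  proof (rule has_integral_spike_finite[of "vn M ` {0..Nv M}", rotated 2])
    fix v assume "v \<in> {-vmax M..vmax M} - vn M ` {0..Nv M}"
    then obtain j where "j \<in> {1..Nv M}" "v \<in> interior (cellK M j)"
      using off_nodes_in_open_cell_v by blast
    then show "g x v = (\<Sum>k\<in>I. c k * b k x v)" by (rule g)
  qed simp
  then show ?thesis unfolding charge_density_def by (simp add: integral_unique)
qed

lemma charge_density_integrable:
  "cellwise_continuous M g \<Longrightarrow> charge_density M g integrable_on {0..len M}"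
  using piecewise_continuous_integrable[OF xn_mono charge_density_piecewise_continuous]
  by (simp add: xn_0 xn_Nx)

lemma enclosed_charge_continuous:
  "cellwise_continuous M g \<Longrightarrow> continuous_on {0..len M} (\<lambda>x. integral {0..x} (charge_density M g))"
  by (intro indefinite_integral_continuous_1 charge_density_integrable)

lemma efield_continuous:
  "cellwise_continuous M g \<Longrightarrow> continuous_on {0..len M} (efield M g)"
  unfolding efield_def[abs_def] by (intro continuous_intros enclosed_charge_continuous)

lemma efield_has_derivative:
  assumes g: "cellwise_continuous M g" and i: "i \<in> {1..Nx M}" and x: "x \<in> interior (cellJ M i)"
  shows "(efield M g has_real_derivative 1 - charge_density M g x) (at x)"
  using piecewise_continuous_integral_has_derivative[OF xn_mono
      charge_density_piecewise_continuous[OF g] i, of x] x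
  unfolding efield_def[abs_def] by (auto intro!: derivative_eq_intros simp: interior_cellJ xn_0)

lemma potential_has_derivative:
  assumes g: "cellwise_continuous M g" and x: "x \<in> {0<..<len M}"
  shows "(potential M g has_real_derivative - efield M g x) (at x)"
proof -
  let ?R = "\<lambda>s. integral {0..s} (charge_density M g)"
  have "((\<lambda>x. integral {0..x} ?R) has_real_derivative ?R x) (at x within {0..len M})"
    using enclosed_charge_continuous[OF g] x by (intro integral_has_real_derivative) auto
  moreover have "at x within {0..len M} = at x"
    using x by (simp add: at_within_Icc_at)
  ultimately have "((\<lambda>x. integral {0..x} ?R) has_real_derivative ?R x) (at x)" by simp
  then show ?thesis
    unfolding potential_def[abs_def] efield_def by (auto intro!: derivative_eq_intros)
qed

lemma potential_continuous:
  assumes g: "cellwise_continuous M g"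
  shows "continuous_on {0..len M} (potential M g)"
proof -
  have "continuous_on {0..len M} (\<lambda>x. integral {0..x} (\<lambda>s. integral {0..s} (charge_density M g)))"
    by (rule indefinite_integral_continuous_1[OF integrable_continuous_real[OF
          enclosed_charge_continuous[OF g]]])
  then show ?thesis
    unfolding potential_def[abs_def] by (auto intro!: continuous_intros)
qed

text \<open>
  The constant \<open>C\<^sub>E\<close> is chosen to make this hold. It removes the boundary terms from the integration
  by parts of the field energy and makes the nodal values of the potential periodic.
\<close>

lemma potential_at_ends: "potential M g 0 = 0" "potential M g (len M) = 0"
  using len_pos by (simp_all add: potential_def C_E_def power2_eq_square field_simps)

end

text \<open>
  The electric field is affine in the density. Its part \<open>x - L / 2\<close>, produced by the uniform
  background, does not depend on the density; what remains is linear, so that applied to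
  \<open>(f\<^sub>h)\<^sub>t\<close> it is the time derivative of \<open>E\<^sub>h\<close>.
\<close>

definition self_field :: "dg_mesh \<Rightarrow> (real \<Rightarrow> real \<Rightarrow> real) \<Rightarrow> real \<Rightarrow> real" where
  "self_field M g x = efield M g x - (x - len M / 2)"

context
  fixes M :: dg_mesh
  assumes mesh: "valid_mesh M"
begin

lemma self_field_continuous:
  "cellwise_continuous M g \<Longrightarrow> continuous_on {0..len M} (self_field M g)"
  unfolding self_field_def[abs_def] divide_inverse by (intro continuous_intros efield_continuous[OF mesh])

lemma self_field_linear:
  assumes fin: "finite I" and b: "\<And>k. k \<in> I \<Longrightarrow> cellwise_continuous M (b k)"
    and g: "\<And>i j x v. i \<in> {1..Nx M} \<Longrightarrow> j \<in> {1..Nv M} \<Longrightarrow> x \<in> interior (cellJ M i) \<Longrightarrow>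
        v \<in> interior (cellK M j) \<Longrightarrow> g x v = (\<Sum>k\<in>I. c k * b k x v)"
    and x: "x \<in> {0..len M}"
  shows "self_field M g x = (\<Sum>k\<in>I. c k * self_field M (b k) x)"
proof -
  have R: "integral {0..s} (charge_density M g)
      = (\<Sum>k\<in>I. c k * integral {0..s} (charge_density M (b k)))" if s: "s \<in> {0..len M}" for s
  proof -
    have "((\<lambda>x. \<Sum>k\<in>I. c k * charge_density M (b k) x) has_integral
        (\<Sum>k\<in>I. c k * integral {0..s} (charge_density M (b k)))) {0..s}"
      using s by (intro has_integral_sum fin has_integral_mult_right integrable_integral
          integrable_on_subinterval[OF charge_density_integrable[OF mesh b]]) auto
    then have "(charge_density M g has_integral
        (\<Sum>k\<in>I. c k * integral {0..s} (charge_density M (b k)))) {0..s}"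
    proof (rule has_integral_spike_finite[of "xn M ` {0..Nx M}", rotated 2])
      fix y assume "y \<in> {0..s} - xn M ` {0..Nx M}"
      then obtain i where "i \<in> {1..Nx M}" "y \<in> interior (cellJ M i)"
        using off_nodes_in_open_cell[OF mesh, of y] s by auto
      then show "charge_density M g y = (\<Sum>k\<in>I. c k * charge_density M (b k) y)"
        by (intro charge_density_linear[OF mesh fin] b g)
    qed simp
    then show ?thesis by (rule integral_unique)
  qed
  have "integral {0..len M} (\<lambda>s. integral {0..s} (charge_density M g))
     = integral {0..len M} (\<lambda>s. \<Sum>k\<in>I. c k * integral {0..s} (charge_density M (b k)))"
    by (intro integral_cong R)
  also have "\<dots> = (\<Sum>k\<in>I. c k * integral {0..len M} (\<lambda>s. integral {0..s} (charge_density M (b k))))"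
    by (intro integral_unique has_integral_sum fin has_integral_mult_right integrable_integral
        integrable_continuous_real enclosed_charge_continuous mesh b)
  finally show ?thesis
    unfolding self_field_def efield_def C_E_def R[OF x]
    by (simp add: sum_distrib_left sum_subtractf[symmetric] algebra_simps)
qed

text \<open>
  Integration by parts with \<open>\<Phi>\<^sub>x = - E\<close> and \<open>(self_field h)\<^sub>x = - \<rho>\<^sub>h\<close>; the boundary terms carry the factor
  \<open>\<Phi>\<close>, which vanishes at both ends. For \<open>h = (f\<^sub>h)\<^sub>t\<close> the left-hand side is the rate of change of the
  field energy.
\<close>

lemma integral_efield_self_field:
  assumes g: "cellwise_continuous M g" and h: "cellwise_continuous M h"
  shows "integral {0..len M} (\<lambda>x. efield M g x * self_field M h x)
       = - integral {0..len M} (\<lambda>x. charge_density M h x * potential M g x)"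
proof -
  have "((\<lambda>x. - (efield M g x * self_field M h x) - charge_density M h x * potential M g x)
      has_integral potential M g (len M) * self_field M h (len M)
        - potential M g 0 * self_field M h 0) {0..len M}"
  proof (rule fundamental_theorem_of_calculus_interior_strong[of "xn M ` {0..Nx M}"])
    fix x assume x: "x \<in> {0<..<len M} - xn M ` {0..Nx M}"
    then obtain i where i: "i \<in> {1..Nx M}" "x \<in> interior (cellJ M i)"
      using off_nodes_in_open_cell[OF mesh, of x] by auto
    have "(self_field M h has_real_derivative - charge_density M h x) (at x)"
      unfolding self_field_def[abs_def]
      by (auto intro!: derivative_eq_intros efield_has_derivative[OF mesh h i])
    moreover have "(potential M g has_real_derivative - efield M g x) (at x)"
      using potential_has_derivative[OF mesh g] x by auto
    ultimately have "((\<lambda>x. potential M g x * self_field M h x) has_real_derivative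
        - (efield M g x * self_field M h x) - charge_density M h x * potential M g x) (at x)"
      by (auto intro!: derivative_eq_intros)
    then show "((\<lambda>x. potential M g x * self_field M h x) has_vector_derivative
        - (efield M g x * self_field M h x) - charge_density M h x * potential M g x) (at x)"
      by (simp add: has_real_derivative_iff_has_vector_derivative)
  qed (use len_pos[OF mesh] in \<open>auto intro!: continuous_intros potential_continuous[OF mesh g]
        self_field_continuous[OF h]\<close>)
  then have "((\<lambda>x. - (efield M g x * self_field M h x) - charge_density M h x * potential M g x)
      has_integral 0) {0..len M}"
    by (simp add: potential_at_ends[OF mesh])
  moreover have "(\<lambda>x. efield M g x * self_field M h x) integrable_on {0..len M}"
    by (intro integrable_continuous_real continuous_intros efield_continuous[OF mesh g]
        self_field_continuous[OF h])
  ultimately have "((\<lambda>x. (- (efield M g x * self_field M h x) - charge_density M h x * potential M g x)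
      + efield M g x * self_field M h x) has_integral 0 + integral {0..len M} (\<lambda>x. efield M g x * self_field M h x)) {0..len M}"
    by (intro has_integral_add integrable_integral)
  then have "((\<lambda>x. - (charge_density M h x * potential M g x)) has_integral
      integral {0..len M} (\<lambda>x. efield M g x * self_field M h x)) {0..len M}"
    by simp
  from has_integral_neg[OF this] show ?thesis
    by (simp add: integral_unique)
qed

end

section \<open>The discrete spaces and their nodal values\<close>

lemma bidegree_set: "{(a, b). a \<le> l \<and> b \<le> l} = {..l} \<times> {..(l::nat)}"
  by auto

lemma W_space_subset_V_space: "W_space M l \<subseteq> V_space M l"
proof
  fix \<phi> assume "\<phi> \<in> W_space M l"
  then have W: "\<exists>c :: nat \<Rightarrow> nat \<Rightarrow> real.
     \<forall>x\<in>interior (cellJ M i). \<forall>v\<in>interior (cellK M j).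
       \<phi> x v = (\<Sum>(a, b) \<in> {(a, b). a + b \<le> l}. c a b * x ^ a * v ^ b)"
    if "i \<in> {1..Nx M}" "j \<in> {1..Nv M}" for i j
    using that unfolding W_space_def by blast
  have "\<exists>c :: nat \<Rightarrow> nat \<Rightarrow> real.
     \<forall>x\<in>interior (cellJ M i). \<forall>v\<in>interior (cellK M j).
       \<phi> x v = (\<Sum>(a, b) \<in> {(a, b). a \<le> l \<and> b \<le> l}. c a b * x ^ a * v ^ b)"
    if ij: "i \<in> {1..Nx M}" "j \<in> {1..Nv M}" for i j
  proof -
    obtain c :: "nat \<Rightarrow> nat \<Rightarrow> real" where c: "\<forall>x\<in>interior (cellJ M i). \<forall>v\<in>interior (cellK M j).
       \<phi> x v = (\<Sum>(a, b) \<in> {(a, b). a + b \<le> l}. c a b * x ^ a * v ^ b)"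
      using W[OF ij] by (elim exE)
    have "(\<Sum>(a, b) \<in> {(a, b). a + b \<le> l}. c a b * x ^ a * v ^ b)
       = (\<Sum>(a, b) \<in> {(a, b). a \<le> l \<and> b \<le> l}. (if a + b \<le> l then c a b else 0) * x ^ a * v ^ b)"
      for x v
      by (rule sum.mono_neutral_cong_left) (auto simp: bidegree_set split: if_splits)
    then show ?thesis
      using c by (intro exI[of _ "\<lambda>a b. if a + b \<le> l then c a b else 0"]) simp
  qed
  then show "\<phi> \<in> V_space M l" unfolding V_space_def by blast
qed

lemma finite_total_degree: "finite {(a, b). a + b \<le> (l::nat)}"
  by (rule finite_subset[of _ "{..l} \<times> {..l}"]) auto

text \<open>
  This admits the projected potential as a test function in both discrete spaces.
\<close>

lemma x_function_in_W_space:
  assumes "u \<in> Z_space M l"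
  shows "(\<lambda>x v. u x) \<in> W_space M l"
  unfolding W_space_def
proof (intro CollectI ballI)
  fix i j assume "i \<in> {1..Nx M}" "j \<in> {1..Nv M}"
  then obtain p :: "real poly" where p: "degree p \<le> l"
      "\<And>x. x \<in> interior (cellJ M i) \<Longrightarrow> u x = poly p x"
    using assms unfolding Z_space_def by blast
  have "poly p x = (\<Sum>(a, b) \<in> {(a, b). a + b \<le> l}. (if b = 0 then coeff p a else 0) * x ^ a * v ^ b)"
    for x v
  proof -
    have "poly p x = (\<Sum>a\<le>degree p. coeff p a * x ^ a)" by (rule poly_altdef)
    also have "\<dots> = (\<Sum>a\<le>l. coeff p a * x ^ a)"
      using p(1) by (intro sum.mono_neutral_left) (auto simp: coeff_eq_0)
    also have "\<dots> = (\<Sum>(a, b)\<in>(\<lambda>a. (a, 0::nat)) ` {..l}. (if b = 0 then coeff p a else 0) * x ^ a * v ^ b)"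
      by (subst sum.reindex) (auto simp: inj_on_def)
    also have "\<dots> = (\<Sum>(a, b) \<in> {(a, b). a + b \<le> l}. (if b = 0 then coeff p a else 0) * x ^ a * v ^ b)"
      by (intro sum.mono_neutral_left finite_total_degree) auto
    finally show ?thesis .
  qed
  then show "\<exists>c :: nat \<Rightarrow> nat \<Rightarrow> real.
     \<forall>x\<in>interior (cellJ M i). \<forall>v\<in>interior (cellK M j).
       u x = (\<Sum>(a, b) \<in> {(a, b). a + b \<le> l}. c a b * x ^ a * v ^ b)"
    using p(2) by (intro exI[of _ "\<lambda>a b. if b = 0 then coeff p a else 0"]) auto
qed

text \<open>
  The weight has total degree two, whence the bound on \<open>l\<close>: below it the scheme could not be tested
  with the kinetic energy density.
\<close>

lemma kinetic_weight_in_W_space: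
  assumes "2 \<le> l"
  shows "(\<lambda>x v. v\<^sup>2 / 2) \<in> W_space M l"
  unfolding W_space_def
proof (intro CollectI ballI)
  fix i j
  have "v\<^sup>2 / 2 = (\<Sum>(a, b) \<in> {(a, b). a + b \<le> l}. (if a = 0 \<and> b = 2 then 1 / 2 else 0) * x ^ a * v ^ b)"
    for x v :: real
  proof -
    have "v\<^sup>2 / 2 = (\<Sum>(a, b) \<in> {(0, 2)}. (if a = 0 \<and> b = 2 then 1 / 2 else 0) * x ^ a * v ^ b)"
      by simp
    also have "\<dots> = (\<Sum>(a, b) \<in> {(a, b). a + b \<le> l}. (if a = 0 \<and> b = 2 then 1 / 2 else 0) * x ^ a * v ^ b)"
      using assms by (intro sum.mono_neutral_left finite_total_degree) (auto split: if_splits)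
    finally show ?thesis .
  qed
  then show "\<exists>c :: nat \<Rightarrow> nat \<Rightarrow> real.
     \<forall>x\<in>interior (cellJ M i). \<forall>v\<in>interior (cellK M j).
       v\<^sup>2 / 2 = (\<Sum>(a, b) \<in> {(a, b). a + b \<le> l}. c a b * x ^ a * v ^ b)"
    by (intro exI[of _ "\<lambda>a b. if a = 0 \<and> b = 2 then 1 / 2 else 0"]) auto
qed

lemma V_space_cellwise_continuous:
  assumes "g \<in> V_space M l"
  shows "cellwise_continuous M g"
  unfolding cellwise_continuous_def
proof (intro ballI)
  fix i j assume "i \<in> {1..Nx M}" "j \<in> {1..Nv M}"
  then obtain c :: "nat \<Rightarrow> nat \<Rightarrow> real" where "\<forall>x\<in>interior (cellJ M i). \<forall>v\<in>interior (cellK M j).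
       g x v = (\<Sum>(a, b) \<in> {(a, b). a \<le> l \<and> b \<le> l}. c a b * x ^ a * v ^ b)"
    using assms unfolding V_space_def by blast
  moreover have "continuous_on (cellI M i j)
      (\<lambda>(x, v). \<Sum>(a, b) \<in> {(a, b). a \<le> l \<and> b \<le> l}. c a b * x ^ a * v ^ b)"
    unfolding case_prod_beta by (intro continuous_intros)
  ultimately show "\<exists>G. continuous_on (cellI M i j) (\<lambda>(x, v). G x v) \<and>
          (\<forall>x\<in>interior (cellJ M i). \<forall>v\<in>interior (cellK M j). g x v = G x v)"
    by (intro exI[of _ "\<lambda>x v. \<Sum>(a, b) \<in> {(a, b). a \<le> l \<and> b \<le> l}. c a b * x ^ a * v ^ b"]) blast
qed

lemma lagrange_interpolation:
  fixes x :: "nat \<Rightarrow> real"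
  assumes inj: "inj_on x {..l}"
  obtains A :: "nat \<Rightarrow> real poly" where
    "\<And>p y. degree p \<le> l \<Longrightarrow> poly p y = (\<Sum>k\<le>l. poly p (x k) * poly (A k) y)"
proof
  define A where "A k = smult (inverse (\<Prod>m\<in>{..l}-{k}. x k - x m)) (\<Prod>m\<in>{..l}-{k}. [:- x m, 1:])"
    for k
  have degA: "degree (A k) \<le> l" if "k \<le> l" for k
  proof -
    have "degree (A k) \<le> degree (\<Prod>m\<in>{..l}-{k}. [:- x m, 1:])"
      unfolding A_def by (rule degree_smult_le)
    also have "\<dots> \<le> sum (degree \<circ> (\<lambda>m. [:- x m, 1:])) ({..l}-{k})"
      by (rule degree_prod_sum_le) simp
    also have "\<dots> = l" using that by simp
    finally show ?thesis .
  qed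
  have A: "poly (A k) (x m) = (if m = k then 1 else 0)" if "k \<le> l" "m \<le> l" for k m
  proof (cases "m = k")
    case True
    have "(\<Prod>m\<in>{..l}-{k}. x k - x m) \<noteq> 0"
      using inj that by (auto simp: inj_on_def)
    then show ?thesis using True by (simp add: A_def poly_prod)
  next
    case False
    then have "(\<Prod>m'\<in>{..l}-{k}. x m - x m') = 0"
      using that by (intro prod_zero) auto
    then show ?thesis using False by (simp add: A_def poly_prod)
  qed
  fix p :: "real poly" and y
  assume p: "degree p \<le> l"
  have "p = (\<Sum>k\<le>l. smult (poly p (x k)) (A k))"
  proof (rule poly_eqI_degree[of "x ` {..l}"])
    show "poly p z = poly (\<Sum>k\<le>l. smult (poly p (x k)) (A k)) z" if z: "z \<in> x ` {..l}" for z
    proof -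
      from z obtain m where m: "m \<le> l" "z = x m" by auto
      have "poly (\<Sum>k\<le>l. smult (poly p (x k)) (A k)) z
          = (\<Sum>k\<le>l. if k = m then poly p (x k) else 0)"
        unfolding poly_sum m by (intro sum.cong) (use m in \<open>auto simp: A\<close>)
      then show ?thesis using m by simp
    qed
    have "degree (\<Sum>k\<le>l. smult (poly p (x k)) (A k)) \<le> l"
      by (rule degree_sum_le) (auto intro: order_trans[OF degree_smult_le] degA)
    then show "degree (\<Sum>k\<le>l. smult (poly p (x k)) (A k)) < card (x ` {..l})"
      using inj by (simp add: card_image)
    show "degree p < card (x ` {..l})"
      using inj p by (simp add: card_image)
  qed
  then have "poly p y = poly (\<Sum>k\<le>l. smult (poly p (x k)) (A k)) y"
    by (rule arg_cong)
  then show "poly p y = (\<Sum>k\<le>l. poly p (x k) * poly (A k) y)"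
    by (simp add: poly_sum)
qed

lemma lagrange_interpolation_in_interval:
  fixes a b :: real
  assumes "a < b"
  shows "\<exists>(X :: nat \<Rightarrow> real) (A :: nat \<Rightarrow> real poly). (\<forall>k\<le>l. X k \<in> {a<..<b}) \<and>
     (\<forall>p y. degree p \<le> l \<longrightarrow> poly p y = (\<Sum>k\<le>l. poly p (X k) * poly (A k) y))"
proof -
  \<comment> \<open>The end points are excluded: members of the discrete spaces are polynomials on open cells only.\<close>
  define X where "X k = a + (b - a) * (real (k + 1) / real (l + 2))" for k
  have "inj_on X {..l}"
    using assms by (auto simp: inj_on_def X_def divide_cancel_right)
  then obtain A where "\<And>p y. degree p \<le> l \<Longrightarrow> poly p y = (\<Sum>k\<le>l. poly p (X k) * poly (A k) y)"
    by (rule lagrange_interpolation) blast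
  moreover have "X k \<in> {a<..<b}" if "k \<le> l" for k
  proof -
    define q where "q = real (k + 1) / real (l + 2)"
    have "0 < q" "q < 1" using that by (auto simp: q_def)
    then have "0 < (b - a) * q" "(b - a) * q < b - a"
      using assms by (auto intro: mult_pos_pos)
    then show ?thesis unfolding X_def q_def[symmetric] by simp
  qed
  ultimately show ?thesis by blast
qed

text \<open>
  A member of the space is determined on each cell by its values at finitely many fixed points, through
  tensor product Lagrange interpolation. Since the coefficients are point values, pointwise
  differentiability in time of \<open>f\<^sub>h\<close> is at once differentiability of its coefficients. The index
  \<open>(i, j, k, m)\<close> is a cell together with a node in it.
\<close>

lemma V_space_nodal_basis:
  assumes mesh: "valid_mesh M"
  obtains I :: "(nat \<times> nat \<times> nat \<times> nat) set" and X Y b where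
    "finite I"
    and "\<And>k. k \<in> I \<Longrightarrow> \<exists>i\<in>{1..Nx M}. \<exists>j\<in>{1..Nv M}. X k \<in> interior (cellJ M i) \<and>
           Y k \<in> interior (cellK M j)"
    and "\<And>k. k \<in> I \<Longrightarrow> cellwise_continuous M (b k)"
    and "\<And>g i j x v. g \<in> V_space M l \<Longrightarrow> i \<in> {1..Nx M} \<Longrightarrow> j \<in> {1..Nv M} \<Longrightarrow>
           x \<in> interior (cellJ M i) \<Longrightarrow> v \<in> interior (cellK M j) \<Longrightarrow>
           g x v = (\<Sum>k\<in>I. g (X k) (Y k) * b k x v)"
proof -
  have "\<exists>(X :: nat \<Rightarrow> real) (A :: nat \<Rightarrow> real poly). (\<forall>k\<le>l. X k \<in> interior (cellJ M i)) \<and>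
     (\<forall>p y. degree p \<le> l \<longrightarrow> poly p y = (\<Sum>k\<le>l. poly p (X k) * poly (A k) y))"
    if "i \<in> {1..Nx M}" for i
    using lagrange_interpolation_in_interval[OF xn_step[OF mesh that]] by (simp add: interior_cellJ)
  then obtain X :: "nat \<Rightarrow> nat \<Rightarrow> real" and A :: "nat \<Rightarrow> nat \<Rightarrow> real poly" where
    X: "\<And>i k. i \<in> {1..Nx M} \<Longrightarrow> k \<le> l \<Longrightarrow> X i k \<in> interior (cellJ M i)" and
    A: "\<And>i p y. i \<in> {1..Nx M} \<Longrightarrow> degree p \<le> l \<Longrightarrow> poly p y = (\<Sum>k\<le>l. poly p (X i k) * poly (A i k) y)"
    by metis
  have "\<exists>(Y :: nat \<Rightarrow> real) (B :: nat \<Rightarrow> real poly). (\<forall>k\<le>l. Y k \<in> interior (cellK M j)) \<and>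
     (\<forall>p y. degree p \<le> l \<longrightarrow> poly p y = (\<Sum>k\<le>l. poly p (Y k) * poly (B k) y))"
    if "j \<in> {1..Nv M}" for j
    using lagrange_interpolation_in_interval[OF vn_step[OF mesh that]] by (simp add: interior_cellK)
  then obtain Y :: "nat \<Rightarrow> nat \<Rightarrow> real" and B :: "nat \<Rightarrow> nat \<Rightarrow> real poly" where
    Y: "\<And>j k. j \<in> {1..Nv M} \<Longrightarrow> k \<le> l \<Longrightarrow> Y j k \<in> interior (cellK M j)" and
    B: "\<And>j p y. j \<in> {1..Nv M} \<Longrightarrow> degree p \<le> l \<Longrightarrow> poly p y = (\<Sum>k\<le>l. poly p (Y j k) * poly (B j k) y)"
    by metis
  define I where "I = {1..Nx M} \<times> {1..Nv M} \<times> {..l} \<times> {..l}"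
  \<comment> \<open>Basis functions are cut off outside their own cell, so that on any cell only its own nodes contribute.\<close>
  define b where "b = (\<lambda>(i, j, k, m) x v. if x \<in> interior (cellJ M i) \<and> v \<in> interior (cellK M j)
      then poly (A i k) x * poly (B j m) v else 0)"
  have disj: "i = i'" if "i \<in> {1..Nx M}" "i' \<in> {1..Nx M}" "x \<in> interior (cellJ M i)"
    "x \<in> interior (cellJ M i')" for i i' x
    using open_cells_disjoint[OF xn_mono[OF mesh], of i i' x] that by (simp add: interior_cellJ)
  have disj': "j = j'" if "j \<in> {1..Nv M}" "j' \<in> {1..Nv M}" "v \<in> interior (cellK M j)"
    "v \<in> interior (cellK M j')" for j j' v
    using open_cells_disjoint[OF vn_mono[OF mesh], of j j' v] that by (simp add: interior_cellK)
  show ?thesis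
  proof (rule that[of I "\<lambda>(i, j, k, m). X i k" "\<lambda>(i, j, k, m). Y j m" b])
    show "finite I" by (simp add: I_def)
    show "\<exists>i\<in>{1..Nx M}. \<exists>j\<in>{1..Nv M}. (case k of (i, j, k, m) \<Rightarrow> X i k) \<in> interior (cellJ M i) \<and>
           (case k of (i, j, k, m) \<Rightarrow> Y j m) \<in> interior (cellK M j)" if "k \<in> I" for k
      using that X Y unfolding I_def by (cases k) force
    show "cellwise_continuous M (b k)" if "k \<in> I" for k
      unfolding cellwise_continuous_def
    proof (intro ballI)
      fix i' j' assume ij': "i' \<in> {1..Nx M}" "j' \<in> {1..Nv M}"
      obtain i j n m where k: "k = (i, j, n, m)" by (cases k)
      show "\<exists>G. continuous_on (cellI M i' j') (\<lambda>(x, v). G x v) \<and>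
          (\<forall>x\<in>interior (cellJ M i'). \<forall>v\<in>interior (cellK M j'). b k x v = G x v)"
      proof (cases "i = i' \<and> j = j'")
        case True
        then show ?thesis
          by (intro exI[of _ "\<lambda>x v. poly (A i n) x * poly (B j m) v"])
             (auto simp: k b_def case_prod_beta intro!: continuous_intros)
      next
        case False
        have ij: "i \<in> {1..Nx M}" "j \<in> {1..Nv M}" using \<open>k \<in> I\<close> by (auto simp: I_def k)
        have "b k x v = 0" if "x \<in> interior (cellJ M i')" "v \<in> interior (cellK M j')" for x v
          using False disj[OF ij(1) ij'(1) _ that(1)] disj'[OF ij(2) ij'(2) _ that(2)]
          by (auto simp: k b_def)
        then show ?thesis by (intro exI[of _ "\<lambda>x v. 0"]) auto
      qed
    qed
    fix g i j x v
    assume g: "g \<in> V_space M l" and i: "i \<in> {1..Nx M}" and j: "j \<in> {1..Nv M}"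
      and x: "x \<in> interior (cellJ M i)" and v: "v \<in> interior (cellK M j)"
    obtain c :: "nat \<Rightarrow> nat \<Rightarrow> real" where "\<forall>x\<in>interior (cellJ M i). \<forall>v\<in>interior (cellK M j).
       g x v = (\<Sum>(a, b) \<in> {..l} \<times> {..l}. c a b * x ^ a * v ^ b)"
      using g i j unfolding V_space_def bidegree_set by blast
    then have c: "g x v = (\<Sum>(a, b) \<in> {..l} \<times> {..l}. c a b * x ^ a * v ^ b)"
      if "x \<in> interior (cellJ M i)" "v \<in> interior (cellK M j)" for x v
      using that by simp
    \<comment> \<open>Interpolation in one variable at a time, with the other one frozen.\<close>
    have gx: "g x v = (\<Sum>k\<le>l. g (X i k) v * poly (A i k) x)"
    proof -
      define p where "p = (\<Sum>(a, b) \<in> {..l} \<times> {..l}. monom (c a b * v ^ b) a)"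
      have p: "poly p y = (\<Sum>(a, b) \<in> {..l} \<times> {..l}. c a b * y ^ a * v ^ b)" for y
        by (simp add: p_def poly_sum poly_monom case_prod_beta mult_ac)
      have "degree p \<le> l"
        unfolding p_def by (rule degree_sum_le) (auto intro: order_trans[OF degree_monom_le])
      from A[OF i this, of x] show ?thesis
        using c[OF x v] c[OF X[OF i] v] by (simp add: p)
    qed
    have gv: "g z v = (\<Sum>m\<le>l. g z (Y j m) * poly (B j m) v)" if z: "z \<in> interior (cellJ M i)" for z
    proof -
      define p where "p = (\<Sum>(a, b) \<in> {..l} \<times> {..l}. monom (c a b * z ^ a) b)"
      have p: "poly p y = (\<Sum>(a, b) \<in> {..l} \<times> {..l}. c a b * z ^ a * y ^ b)" for y
        by (simp add: p_def poly_sum poly_monom case_prod_beta mult_ac)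
      have "degree p \<le> l"
        unfolding p_def by (rule degree_sum_le) (auto intro: order_trans[OF degree_monom_le])
      from B[OF j this, of v] show ?thesis
        using c[OF z v] c[OF z Y[OF j]] by (simp add: p)
    qed
    have "(\<Sum>k\<in>I. g (case k of (i, j, k, m) \<Rightarrow> X i k) (case k of (i, j, k, m) \<Rightarrow> Y j m) * b k x v)
       = (\<Sum>(i', j', k, m)\<in>I. g (X i' k) (Y j' m) * b (i', j', k, m) x v)"
      by (rule sum.cong) auto
    also have "\<dots> = (\<Sum>(i', j', k, m)\<in>{i} \<times> {j} \<times> {..l} \<times> {..l}. g (X i' k) (Y j' m) * b (i', j', k, m) x v)"
    proof (rule sum.mono_neutral_right)
      show "\<forall>k\<in>I - {i} \<times> {j} \<times> {..l} \<times> {..l}.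
          (case k of (i', j', k, m) \<Rightarrow> g (X i' k) (Y j' m) * b (i', j', k, m) x v) = 0"
        using disj[OF i _ x] disj'[OF j _ v] by (auto simp: b_def I_def split: if_splits)
    qed (use i j in \<open>auto simp: I_def\<close>)
    also have "\<dots> = (\<Sum>k\<le>l. \<Sum>m\<le>l. g (X i k) (Y j m) * (poly (A i k) x * poly (B j m) v))"
      using x v by (simp add: sum.cartesian_product[symmetric] b_def)
    also have "\<dots> = (\<Sum>k\<le>l. g (X i k) v * poly (A i k) x)"
      by (intro sum.cong refl) (simp add: gv[OF X[OF i]] sum_distrib_left mult_ac)
    finally show "g x v = (\<Sum>k\<in>I. g (case k of (i, j, k, m) \<Rightarrow> X i k)
        (case k of (i, j, k, m) \<Rightarrow> Y j m) * b k x v)"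
      using gx by simp
  qed
qed

section \<open>Differentiating the energy in time\<close>

text \<open>
  The rates of the coefficients may be discontinuous in time, so the derivative is not taken under
  the integral sign: expanding the square leaves a quadratic polynomial in the coefficients.
\<close>

lemma has_real_derivative_integral_square:
  fixes e0 :: "real \<Rightarrow> real" and e :: "'k \<Rightarrow> real \<Rightarrow> real"
  assumes fin: "finite I"
    and e0: "continuous_on {a..b} e0" and e: "\<And>k. k \<in> I \<Longrightarrow> continuous_on {a..b} (e k)"
    and c: "\<And>k. k \<in> I \<Longrightarrow> ((\<lambda>s. c s k) has_real_derivative c' k) (at t within X)"
  shows "((\<lambda>s. integral {a..b} (\<lambda>x. (e0 x + (\<Sum>k\<in>I. c s k * e k x))\<^sup>2)) has_real_derivative
           integral {a..b} (\<lambda>x. 2 * ((e0 x + (\<Sum>k\<in>I. c t k * e k x)) * (\<Sum>k\<in>I. c' k * e k x))))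
         (at t within X)"
proof -
  define m where "m k = integral {a..b} (\<lambda>x. e0 x * e k x)" for k
  define mm where "mm k k' = integral {a..b} (\<lambda>x. e k x * e k' x)" for k k'
  have i0: "(\<lambda>x. e0 x * e0 x) integrable_on {a..b}"
    using e0 by (intro integrable_continuous_real continuous_intros)
  have i1: "(\<lambda>x. e0 x * e k x) integrable_on {a..b}" if "k \<in> I" for k
    using e0 e that by (intro integrable_continuous_real continuous_intros) auto
  have i2: "(\<lambda>x. e k x * e k' x) integrable_on {a..b}" if "k \<in> I" "k' \<in> I" for k k'
    using e that by (intro integrable_continuous_real continuous_intros) auto
  have expand: "integral {a..b} (\<lambda>x. (e0 x + (\<Sum>k\<in>I. c s k * e k x))\<^sup>2) =
      integral {a..b} (\<lambda>x. e0 x * e0 x) + 2 * (\<Sum>k\<in>I. c s k * m k)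
      + (\<Sum>k\<in>I. \<Sum>k'\<in>I. c s k * c s k' * mm k k')" for s
  proof -
    have "(e0 x + (\<Sum>k\<in>I. c s k * e k x))\<^sup>2 =
       e0 x * e0 x + 2 * (\<Sum>k\<in>I. c s k * (e0 x * e k x))
        + (\<Sum>k\<in>I. \<Sum>k'\<in>I. (c s k * c s k') * (e k x * e k' x))" for x
    proof -
      have "(\<Sum>k\<in>I. c s k * e k x) * (\<Sum>k\<in>I. c s k * e k x) =
          (\<Sum>k\<in>I. \<Sum>k'\<in>I. (c s k * c s k') * (e k x * e k' x))"
        unfolding sum_product by (simp add: mult_ac)
      moreover have "e0 x * (\<Sum>k\<in>I. c s k * e k x) = (\<Sum>k\<in>I. c s k * (e0 x * e k x))"
        by (simp add: sum_distrib_left mult_ac)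
      ultimately show ?thesis by (simp add: power2_eq_square algebra_simps)
    qed
    then have "(\<lambda>x. (e0 x + (\<Sum>k\<in>I. c s k * e k x))\<^sup>2) =
       (\<lambda>x. e0 x * e0 x + 2 * (\<Sum>k\<in>I. c s k * (e0 x * e k x))
        + (\<Sum>k\<in>I. \<Sum>k'\<in>I. (c s k * c s k') * (e k x * e k' x)))"
      by (rule ext)
    moreover have "((\<lambda>x. e0 x * e0 x + 2 * (\<Sum>k\<in>I. c s k * (e0 x * e k x))
        + (\<Sum>k\<in>I. \<Sum>k'\<in>I. (c s k * c s k') * (e k x * e k' x))) has_integral
        integral {a..b} (\<lambda>x. e0 x * e0 x) + 2 * (\<Sum>k\<in>I. c s k * m k)
      + (\<Sum>k\<in>I. \<Sum>k'\<in>I. c s k * c s k' * mm k k')) {a..b}"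
      unfolding m_def mm_def
      by (intro has_integral_add has_integral_mult_right has_integral_sum fin
            integrable_integral i0 i1 i2)
    ultimately show ?thesis by (simp add: integral_unique)
  qed
  have deriv: "integral {a..b} (\<lambda>x. 2 * ((e0 x + (\<Sum>k\<in>I. c t k * e k x)) * (\<Sum>k\<in>I. c' k * e k x)))
     = 2 * (\<Sum>k\<in>I. c' k * m k) + (\<Sum>k\<in>I. \<Sum>k'\<in>I. 2 * (c' k * c t k') * mm k k')"
  proof -
    have "2 * ((e0 x + (\<Sum>k\<in>I. c t k * e k x)) * (\<Sum>k\<in>I. c' k * e k x)) =
       2 * (\<Sum>k\<in>I. c' k * (e0 x * e k x))
        + (\<Sum>k\<in>I. \<Sum>k'\<in>I. (2 * (c' k * c t k')) * (e k x * e k' x))" for x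
    proof -
      have "(\<Sum>k\<in>I. c' k * e k x) * (\<Sum>k\<in>I. c t k * e k x) =
          (\<Sum>k\<in>I. \<Sum>k'\<in>I. (c' k * c t k') * (e k x * e k' x))"
        unfolding sum_product by (simp add: mult_ac)
      moreover have "e0 x * (\<Sum>k\<in>I. c' k * e k x) = (\<Sum>k\<in>I. c' k * (e0 x * e k x))"
        by (simp add: sum_distrib_left mult_ac)
      moreover have "(\<Sum>k\<in>I. \<Sum>k'\<in>I. (2 * (c' k * c t k')) * (e k x * e k' x))
          = 2 * (\<Sum>k\<in>I. \<Sum>k'\<in>I. (c' k * c t k') * (e k x * e k' x))"
        by (simp add: sum_distrib_left mult_ac)
      ultimately show ?thesis by (simp add: algebra_simps)
    qed
    then have "(\<lambda>x. 2 * ((e0 x + (\<Sum>k\<in>I. c t k * e k x)) * (\<Sum>k\<in>I. c' k * e k x))) =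
       (\<lambda>x. 2 * (\<Sum>k\<in>I. c' k * (e0 x * e k x))
        + (\<Sum>k\<in>I. \<Sum>k'\<in>I. (2 * (c' k * c t k')) * (e k x * e k' x)))"
      by (rule ext)
    moreover have "((\<lambda>x. 2 * (\<Sum>k\<in>I. c' k * (e0 x * e k x))
        + (\<Sum>k\<in>I. \<Sum>k'\<in>I. (2 * (c' k * c t k')) * (e k x * e k' x))) has_integral
        2 * (\<Sum>k\<in>I. c' k * m k)
      + (\<Sum>k\<in>I. \<Sum>k'\<in>I. 2 * (c' k * c t k') * mm k k')) {a..b}"
      unfolding m_def mm_def
      by (intro has_integral_add has_integral_mult_right has_integral_sum fin
            integrable_integral i0 i1 i2)
    ultimately show ?thesis by (simp add: integral_unique)
  qed
  have sym: "mm k k' = mm k' k" for k k'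
    unfolding mm_def by (simp add: mult.commute)
  have "((\<lambda>s. integral {a..b} (\<lambda>x. e0 x * e0 x) + 2 * (\<Sum>k\<in>I. c s k * m k)
      + (\<Sum>k\<in>I. \<Sum>k'\<in>I. c s k * c s k' * mm k k')) has_real_derivative
      0 + 2 * (\<Sum>k\<in>I. c' k * m k)
      + (\<Sum>k\<in>I. \<Sum>k'\<in>I. (c' k * c t k' + c' k' * c t k) * mm k k')) (at t within X)"
    by (intro DERIV_add DERIV_const DERIV_cmult DERIV_sum DERIV_cmult_right DERIV_mult c)
  also have "(\<Sum>k\<in>I. \<Sum>k'\<in>I. (c' k * c t k' + c' k' * c t k) * mm k k')
     = (\<Sum>k\<in>I. \<Sum>k'\<in>I. c' k * c t k' * mm k k') + (\<Sum>k\<in>I. \<Sum>k'\<in>I. c' k' * c t k * mm k k')"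
    by (simp add: distrib_right sum.distrib)
  also have "(\<Sum>k\<in>I. \<Sum>k'\<in>I. c' k' * c t k * mm k k') = (\<Sum>k\<in>I. \<Sum>k'\<in>I. c' k * c t k' * mm k k')"
    by (subst sum.swap) (simp add: sym)
  finally have *: "((\<lambda>s. integral {a..b} (\<lambda>x. e0 x * e0 x) + 2 * (\<Sum>k\<in>I. c s k * m k)
      + (\<Sum>k\<in>I. \<Sum>k'\<in>I. c s k * c s k' * mm k k')) has_real_derivative
      0 + 2 * (\<Sum>k\<in>I. c' k * m k)
      + ((\<Sum>k\<in>I. \<Sum>k'\<in>I. c' k * c t k' * mm k k') + (\<Sum>k\<in>I. \<Sum>k'\<in>I. c' k * c t k' * mm k k')))
      (at t within X)" .
  have "(\<Sum>k\<in>I. \<Sum>k'\<in>I. 2 * (c' k * c t k') * mm k k')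
      = 2 * (\<Sum>k\<in>I. \<Sum>k'\<in>I. c' k * c t k' * mm k k')"
    unfolding sum_distrib_left by (simp only: mult.assoc)
  with * show ?thesis
    unfolding expand deriv by (simp only: add_0 mult_2)
qed

lemma cellwise_continuous_linear:
  assumes b: "\<And>k. k \<in> I \<Longrightarrow> cellwise_continuous M (b k)"
    and g: "\<And>i j x v. i \<in> {1..Nx M} \<Longrightarrow> j \<in> {1..Nv M} \<Longrightarrow> x \<in> interior (cellJ M i) \<Longrightarrow>
        v \<in> interior (cellK M j) \<Longrightarrow> g x v = (\<Sum>k\<in>I. c k * b k x v)"
  shows "cellwise_continuous M g"
  unfolding cellwise_continuous_def
proof (intro ballI)
  fix i j assume ij: "i \<in> {1..Nx M}" "j \<in> {1..Nv M}"
  have "\<forall>k\<in>I. \<exists>G. continuous_on (cellI M i j) (\<lambda>(x, v). G x v) \<and>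
          (\<forall>x\<in>interior (cellJ M i). \<forall>v\<in>interior (cellK M j). b k x v = G x v)"
    using b ij unfolding cellwise_continuous_def by blast
  then obtain G where G: "\<forall>k\<in>I. continuous_on (cellI M i j) (\<lambda>(x, v). G k x v) \<and>
          (\<forall>x\<in>interior (cellJ M i). \<forall>v\<in>interior (cellK M j). b k x v = G k x v)"
    by metis
  have "continuous_on (cellI M i j) (\<lambda>(x, v). \<Sum>k\<in>I. c k * G k x v)"
    using G unfolding case_prod_beta by (intro continuous_intros) auto
  moreover have "\<forall>x\<in>interior (cellJ M i). \<forall>v\<in>interior (cellK M j). g x v = (\<Sum>k\<in>I. c k * G k x v)"
    using g[OF ij] G by (auto intro!: sum.cong)
  ultimately show "\<exists>G. continuous_on (cellI M i j) (\<lambda>(x, v). G x v) \<and>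
          (\<forall>x\<in>interior (cellJ M i). \<forall>v\<in>interior (cellK M j). g x v = G x v)"
    by (intro exI[of _ "\<lambda>x v. \<Sum>k\<in>I. c k * G k x v"]) blast
qed

lemma kinetic_integral_linear:
  assumes fin: "finite I" and b: "\<And>k. k \<in> I \<Longrightarrow> cellwise_continuous M (b k)"
    and g: "\<And>i j x v. i \<in> {1..Nx M} \<Longrightarrow> j \<in> {1..Nv M} \<Longrightarrow> x \<in> interior (cellJ M i) \<Longrightarrow>
        v \<in> interior (cellK M j) \<Longrightarrow> g x v = (\<Sum>k\<in>I. c k * b k x v)"
  shows "(\<Sum>i=1..Nx M. \<Sum>j=1..Nv M. integral (cellI M i j) (\<lambda>(x, v). g x v * v\<^sup>2))
       = (\<Sum>k\<in>I. c k *
           (\<Sum>i=1..Nx M. \<Sum>j=1..Nv M. integral (cellI M i j) (\<lambda>(x, v). b k x v * v\<^sup>2)))"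
proof -
  have cell: "integral (cellI M i j) (\<lambda>(x, v). g x v * v\<^sup>2)
     = (\<Sum>k\<in>I. c k * integral (cellI M i j) (\<lambda>(x, v). b k x v * v\<^sup>2))"
    if ij: "i \<in> {1..Nx M}" "j \<in> {1..Nv M}" for i j
  proof -
    have "((\<lambda>p. \<Sum>k\<in>I. c k * (case p of (x, v) \<Rightarrow> b k x v * v\<^sup>2)) has_integral
       (\<Sum>k\<in>I. c k * integral (cellI M i j) (\<lambda>(x, v). b k x v * v\<^sup>2))) (cellI M i j)"
      by (intro has_integral_sum fin has_integral_mult_right integrable_integral
            cellwise_continuous_times_integrable b ij)
         (auto simp: case_prod_beta intro!: continuous_intros)
    then have "((\<lambda>(x, v). \<Sum>k\<in>I. c k * (b k x v * v\<^sup>2)) has_integral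
       (\<Sum>k\<in>I. c k * integral (cellI M i j) (\<lambda>(x, v). b k x v * v\<^sup>2))) (cellI M i j)"
      by (simp only: case_prod_unfold)
    then have "((\<lambda>(x, v). g x v * v\<^sup>2) has_integral
       (\<Sum>k\<in>I. c k * integral (cellI M i j) (\<lambda>(x, v). b k x v * v\<^sup>2))) (cellI M i j)"
      by (rule has_integral_cell_spike) (simp add: g[OF ij] sum_distrib_left mult_ac)
    then show ?thesis by (rule integral_unique)
  qed
  have "(\<Sum>i=1..Nx M. \<Sum>j=1..Nv M. integral (cellI M i j) (\<lambda>(x, v). g x v * v\<^sup>2))
     = (\<Sum>i=1..Nx M. \<Sum>j=1..Nv M. \<Sum>k\<in>I. c k * integral (cellI M i j) (\<lambda>(x, v). b k x v * v\<^sup>2))"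
    by (intro sum.cong refl cell)
  also have "\<dots> = (\<Sum>i=1..Nx M. \<Sum>k\<in>I. \<Sum>j=1..Nv M. c k * integral (cellI M i j) (\<lambda>(x, v). b k x v * v\<^sup>2))"
    by (intro sum.cong refl sum.swap)
  also have "\<dots> = (\<Sum>k\<in>I. \<Sum>i=1..Nx M. \<Sum>j=1..Nv M. c k * integral (cellI M i j) (\<lambda>(x, v). b k x v * v\<^sup>2))"
    by (rule sum.swap)
  finally show ?thesis by (simp add: sum_distrib_left)
qed

text \<open>
  In the nodal basis the kinetic energy is linear and the field energy is quadratic in the
  coefficients. The second summand is the integral of \<open>E\<^sub>h (E\<^sub>h)\<^sub>t\<close>.
\<close>

lemma energy_has_derivative:
  assumes mesh: "valid_mesh M" and T: "T > 0" and t: "t \<in> {0..T}"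
    and V: "\<And>s. s \<in> {0..T} \<Longrightarrow> fh s \<in> V_space M l"
    and diff: "\<And>i j x v. i \<in> {1..Nx M} \<Longrightarrow> j \<in> {1..Nv M} \<Longrightarrow> x \<in> interior (cellJ M i) \<Longrightarrow>
        v \<in> interior (cellK M j) \<Longrightarrow> (\<lambda>s. fh s x v) differentiable (at t within {0..T})"
  shows "cellwise_continuous M (time_deriv T fh t)"
    and "((\<lambda>s. energy M (fh s)) has_real_derivative
           1 / 2 * (\<Sum>i=1..Nx M. \<Sum>j=1..Nv M.
              integral (cellI M i j) (\<lambda>(x, v). time_deriv T fh t x v * v\<^sup>2))
           + integral {0..len M} (\<lambda>x. efield M (fh t) x * self_field M (time_deriv T fh t) x))
         (at t within {0..T})"
proof -
  obtain I :: "(nat \<times> nat \<times> nat \<times> nat) set" and X Y b where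
    fin: "finite I"
    and XY: "\<And>k. k \<in> I \<Longrightarrow> \<exists>i\<in>{1..Nx M}. \<exists>j\<in>{1..Nv M}. X k \<in> interior (cellJ M i) \<and>
           Y k \<in> interior (cellK M j)"
    and b: "\<And>k. k \<in> I \<Longrightarrow> cellwise_continuous M (b k)"
    and rep: "\<And>g i j x v. g \<in> V_space M l \<Longrightarrow> i \<in> {1..Nx M} \<Longrightarrow> j \<in> {1..Nv M} \<Longrightarrow>
           x \<in> interior (cellJ M i) \<Longrightarrow> v \<in> interior (cellK M j) \<Longrightarrow>
           g x v = (\<Sum>k\<in>I. g (X k) (Y k) * b k x v)"
    by (rule V_space_nodal_basis[OF mesh, of l]) blast
  let ?g' = "time_deriv T fh t"
  define c where "c s k = fh s (X k) (Y k)" for s k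
  define c' where "c' k = ?g' (X k) (Y k)" for k
  have c': "((\<lambda>s. c s k) has_real_derivative c' k) (at t within {0..T})" if "k \<in> I" for k
    using XY[OF that] diff unfolding c_def c'_def time_deriv_def
    by (auto simp: has_real_derivative_iff_has_vector_derivative vector_derivative_works[symmetric])
  have rep_fh: "fh s x v = (\<Sum>k\<in>I. c s k * b k x v)"
    if "s \<in> {0..T}" "i \<in> {1..Nx M}" "j \<in> {1..Nv M}" "x \<in> interior (cellJ M i)"
      "v \<in> interior (cellK M j)" for s i j x v
    unfolding c_def by (rule rep[OF V[OF that(1)] that(2-5)])
  \<comment> \<open>The time derivative has the same representation, by uniqueness of derivatives at each point.\<close>
  have rep': "?g' x v = (\<Sum>k\<in>I. c' k * b k x v)"
    if "i \<in> {1..Nx M}" "j \<in> {1..Nv M}" "x \<in> interior (cellJ M i)" "v \<in> interior (cellK M j)"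
    for i j x v
  proof -
    have "((\<lambda>s. \<Sum>k\<in>I. c s k * b k x v) has_real_derivative (\<Sum>k\<in>I. c' k * b k x v))
        (at t within {0..T})"
      by (intro DERIV_sum DERIV_cmult_right c')
    then have "((\<lambda>s. fh s x v) has_real_derivative (\<Sum>k\<in>I. c' k * b k x v)) (at t within {0..T})"
      by (rule has_field_derivative_transform_within[of _ _ _ _ 1])
         (use t rep_fh[OF _ that] in auto)
    then show ?thesis
      unfolding time_deriv_def has_real_derivative_iff_has_vector_derivative
      by (intro vector_derivative_within_closed_interval T t)
  qed
  show g': "cellwise_continuous M ?g'"
    using b rep' by (rule cellwise_continuous_linear)
  define kin where "kin k = (\<Sum>i=1..Nx M. \<Sum>j=1..Nv M.
     integral (cellI M i j) (\<lambda>(x, v). b k x v * v\<^sup>2))" for k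
  define e0 where "e0 x = x - len M / 2" for x
  have E: "efield M (fh s) x = e0 x + (\<Sum>k\<in>I. c s k * self_field M (b k) x)"
    if "s \<in> {0..T}" "x \<in> {0..len M}" for s x
  proof -
    have "self_field M (fh s) x = (\<Sum>k\<in>I. c s k * self_field M (b k) x)"
      by (rule self_field_linear[OF mesh fin]) (use b rep_fh that in blast)+
    then show ?thesis by (simp add: self_field_def e0_def)
  qed
  have en: "energy M (fh s) = 1 / 2 * (\<Sum>k\<in>I. c s k * kin k)
      + 1 / 2 * integral {0..len M} (\<lambda>x. (e0 x + (\<Sum>k\<in>I. c s k * self_field M (b k) x))\<^sup>2)"
    if s: "s \<in> {0..T}" for s
  proof -
    have "(\<Sum>i=1..Nx M. integral (cellJ M i) (\<lambda>x. (efield M (fh s) x)\<^sup>2))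
       = integral {0..len M} (\<lambda>x. (efield M (fh s) x)\<^sup>2)"
      by (intro sum_cellJ_integral[OF mesh] continuous_intros efield_continuous[OF mesh]
          V_space_cellwise_continuous[OF V[OF s]])
    also have "\<dots> = integral {0..len M} (\<lambda>x. (e0 x + (\<Sum>k\<in>I. c s k * self_field M (b k) x))\<^sup>2)"
      by (intro integral_cong) (simp add: E[OF s])
    finally have field: "(\<Sum>i=1..Nx M. integral (cellJ M i) (\<lambda>x. (efield M (fh s) x)\<^sup>2))
       = integral {0..len M} (\<lambda>x. (e0 x + (\<Sum>k\<in>I. c s k * self_field M (b k) x))\<^sup>2)" .
    have "(\<Sum>i=1..Nx M. \<Sum>j=1..Nv M. integral (cellI M i j) (\<lambda>(x, v). fh s x v * v\<^sup>2))
       = (\<Sum>k\<in>I. c s k * kin k)"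
      unfolding kin_def by (rule kinetic_integral_linear[OF fin]) (use b rep_fh s in blast)+
    then show ?thesis unfolding energy_def by (simp only: field)
  qed
  have "((\<lambda>s. 1 / 2 * (\<Sum>k\<in>I. c s k * kin k)
      + 1 / 2 * integral {0..len M} (\<lambda>x. (e0 x + (\<Sum>k\<in>I. c s k * self_field M (b k) x))\<^sup>2))
      has_real_derivative 1 / 2 * (\<Sum>k\<in>I. c' k * kin k)
      + 1 / 2 * integral {0..len M} (\<lambda>x. 2 * ((e0 x + (\<Sum>k\<in>I. c t k * self_field M (b k) x))
           * (\<Sum>k\<in>I. c' k * self_field M (b k) x)))) (at t within {0..T})"
    unfolding e0_def
    by (intro DERIV_add DERIV_cmult DERIV_sum DERIV_cmult_right c'
        has_real_derivative_integral_square fin self_field_continuous[OF mesh] b)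
       (auto intro!: continuous_intros)
  then have "((\<lambda>s. energy M (fh s)) has_real_derivative 1 / 2 * (\<Sum>k\<in>I. c' k * kin k)
      + 1 / 2 * integral {0..len M} (\<lambda>x. 2 * ((e0 x + (\<Sum>k\<in>I. c t k * self_field M (b k) x))
           * (\<Sum>k\<in>I. c' k * self_field M (b k) x)))) (at t within {0..T})"
    by (rule has_field_derivative_transform_within[of _ _ _ _ 1]) (use t en in auto)
  moreover have "(\<Sum>k\<in>I. c' k * kin k) = (\<Sum>i=1..Nx M. \<Sum>j=1..Nv M.
      integral (cellI M i j) (\<lambda>(x, v). ?g' x v * v\<^sup>2))"
    unfolding kin_def 
    by (rule kinetic_integral_linear[OF fin, symmetric]) (use b rep' in blast)+
  moreover have "self_field M ?g' x = (\<Sum>k\<in>I. c' k * self_field M (b k) x)"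
    if "x \<in> {0..len M}" for x
    by (rule self_field_linear[OF mesh fin]) (use b rep' that in blast)+
  then have "integral {0..len M} (\<lambda>x. 2 * ((e0 x + (\<Sum>k\<in>I. c t k * self_field M (b k) x))
           * (\<Sum>k\<in>I. c' k * self_field M (b k) x)))
      = integral {0..len M} (\<lambda>x. 2 * (efield M (fh t) x * self_field M ?g' x))"
    by (intro integral_cong) (simp add: E[OF t])
  ultimately show "((\<lambda>s. energy M (fh s)) has_real_derivative
           1 / 2 * (\<Sum>i=1..Nx M. \<Sum>j=1..Nv M.
              integral (cellI M i j) (\<lambda>(x, v). ?g' x v * v\<^sup>2))
           + integral {0..len M} (\<lambda>x. efield M (fh t) x * self_field M ?g' x))
         (at t within {0..T})"
    by simp
qed

section \<open>Cancellation of the numerical fluxes\<close>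

lemma filtermap_at_left_shift: "filtermap (\<lambda>x. x - d) (at_left a) = at_left (a - d)"
  for a d :: real
  by (simp add: filter_eq_iff eventually_filtermap eventually_at_filter
      filtermap_nhds_shift[symmetric])

text \<open>
  Periodicity identifies the two one-sided limits at \<open>L\<close> with those at \<open>0\<close>, whether or not they
  exist.
\<close>

lemma flux_x_periodic:
  assumes mesh: "valid_mesh M" and per: "\<And>x v. g (x + len M) v = g x v"
  shows "flux_x M g (Nx M) j v = flux_x M g 0 j v"
proof -
  have per': "g (x - len M) v = g x v" for x
    using per[of "x - len M" v] by simp
  have "(((\<lambda>x. g x v) \<longlongrightarrow> y) (at_left 0)) = (((\<lambda>x. g x v) \<longlongrightarrow> y) (at_left (len M)))" for y
  proof -
    have "at_left 0 = filtermap (\<lambda>x. x - len M) (at_left (len M))"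
      by (simp add: filtermap_at_left_shift)
    then show ?thesis by (simp add: filterlim_filtermap per')
  qed
  moreover have "(((\<lambda>x. g x v) \<longlongrightarrow> y) (at_right 0)) = (((\<lambda>x. g x v) \<longlongrightarrow> y) (at_right (len M)))" for y
  proof -
    have "at_right 0 = filtermap (\<lambda>x. x - len M) (at_right (len M))"
      by (simp add: filtermap_at_right_shift)
    then show ?thesis by (simp add: filterlim_filtermap per')
  qed
  ultimately show ?thesis
    by (simp add: flux_x_def trace_x_minus_def trace_x_plus_def Topological_Spaces.Lim_def xn_0[OF mesh] xn_Nx[OF mesh])
qed

lemma flux_v_boundary:
  assumes mesh: "valid_mesh M" and van: "vanishes_at_vmax M g"
    and i: "i \<in> {1..Nx M}" and x: "x \<in> interior (cellJ M i)" and j: "j = 0 \<or> j = Nv M"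
  shows "flux_v M g i j x = 0"
proof -
  have "vn M j \<in> {- vmax M, vmax M}"
    using j vn_0[OF mesh] vn_Nv[OF mesh] by auto
  then have "(g x \<longlongrightarrow> 0) (at_left (vn M j))" "(g x \<longlongrightarrow> 0) (at_right (vn M j))"
    using van i x unfolding vanishes_at_vmax_def by blast+
  then show ?thesis
    by (simp add: flux_v_def trace_v_minus_def trace_v_plus_def tendsto_Lim)
qed

text \<open>
  If a test function has single-valued traces \<open>\<alpha>\<close>, \<open>\<beta>\<close> on the interfaces, the flux through an interface
  enters the two adjacent cells with the same factor and opposite signs. The fluxes in \<open>x\<close> then
  telescope around the period, those in \<open>v\<close> to the boundary \<open>v = \<plusminus>V\<^sub>c\<close>, where \<open>f\<^sub>h\<close> has zero traces.
\<close>

lemma sum_dg_form_continuous_test: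
  assumes mesh: "valid_mesh M" and per: "\<And>x v. g (x + len M) v = g x v"
    and van: "vanishes_at_vmax M g"
    and x_minus: "\<And>i v. i \<in> {1..Nx M} \<Longrightarrow> trace_x_minus \<phi> (xn M i) v = \<alpha> i v"
    and x_plus: "\<And>i v. i < Nx M \<Longrightarrow> trace_x_plus \<phi> (xn M i) v = \<alpha> i v"
    and x_per: "\<alpha> (Nx M) = \<alpha> 0"
    and v_minus: "\<And>j x. j \<in> {1..Nv M} \<Longrightarrow> trace_v_minus \<phi> x (vn M j) = \<beta> j x"
    and v_plus: "\<And>j x. j < Nv M \<Longrightarrow> trace_v_plus \<phi> x (vn M j) = \<beta> j x"
  shows "(\<Sum>i=1..Nx M. \<Sum>j=1..Nv M. dg_form M g g' \<phi> i j)
     = (\<Sum>i=1..Nx M. \<Sum>j=1..Nv M.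
          integral (cellI M i j) (\<lambda>(x, v). g' x v * \<phi> x v)
        - integral (cellI M i j) (\<lambda>(x, v). v * g x v * deriv (\<lambda>y. \<phi> y v) x)
        + integral (cellI M i j) (\<lambda>(x, v). efield M g x * g x v * deriv (\<phi> x) v))"
proof -
  define vol where "vol i j = integral (cellI M i j) (\<lambda>(x, v). g' x v * \<phi> x v)
        - integral (cellI M i j) (\<lambda>(x, v). v * g x v * deriv (\<lambda>y. \<phi> y v) x)
        + integral (cellI M i j) (\<lambda>(x, v). efield M g x * g x v * deriv (\<phi> x) v)" for i j
  \<comment> \<open>The flux terms attached to the \<open>x\<close>-face \<open>i\<close> and to the \<open>v\<close>-face \<open>j\<close>, node \<open>0\<close> included.\<close>
  define Fx where "Fx i j = integral (cellK M j) (\<lambda>v. flux_x M g i j v * \<alpha> i v)" for i j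
  define Fv where "Fv i j = integral (cellJ M i) (\<lambda>x. flux_v M g i j x * \<beta> j x)" for i j
  have form: "dg_form M g g' \<phi> i j = vol i j + (Fx i j - Fx (i - 1) j) - (Fv i j - Fv i (j - 1))"
    if "i \<in> {1..Nx M}" "j \<in> {1..Nv M}" for i j
  proof -
    have "i - 1 < Nx M" "j - 1 < Nv M" using that by auto
    then show ?thesis
      using that by (simp add: dg_form_def vol_def Fx_def Fv_def x_minus x_plus v_minus v_plus
        del: One_nat_def)
  qed
  have Fx: "(\<Sum>i=1..Nx M. Fx i j - Fx (i - 1) j) = 0" for j
  proof -
    have "(\<Sum>i=1..Nx M. Fx i j - Fx (i - 1) j) = Fx (Nx M) j - Fx 0 j"
      using sum_telescope''[of 0 "Nx M" "\<lambda>i. Fx i j"] by simp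
    then show ?thesis
      by (simp add: Fx_def flux_x_periodic[where g = g, OF mesh per] x_per)
  qed
  have Fv: "(\<Sum>j=1..Nv M. Fv i j - Fv i (j - 1)) = 0" if i: "i \<in> {1..Nx M}" for i
  proof -
    have "Fv i j = 0" if "j = 0 \<or> j = Nv M" for j
    proof -
      have "((\<lambda>x. flux_v M g i j x * \<beta> j x) has_integral integral {xn M (i - 1)..xn M i} (\<lambda>x. 0))
          {xn M (i - 1)..xn M i}"
        by (rule has_integral_open_interval_eq)
           (use flux_v_boundary[OF mesh van i _ that] in \<open>auto simp: interior_cellJ\<close>)
      then show ?thesis by (simp add: Fv_def cellJ_def integral_unique)
    qed
    moreover have "(\<Sum>j=1..Nv M. Fv i j - Fv i (j - 1)) = Fv i (Nv M) - Fv i 0"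
      using sum_telescope''[of 0 "Nv M" "Fv i"] by simp
    ultimately show ?thesis by simp
  qed
  have "(\<Sum>i=1..Nx M. \<Sum>j=1..Nv M. dg_form M g g' \<phi> i j)
    = (\<Sum>i=1..Nx M. \<Sum>j=1..Nv M. vol i j + (Fx i j - Fx (i - 1) j) - (Fv i j - Fv i (j - 1)))"
    by (intro sum.cong refl form)
  also have "\<dots> = (\<Sum>i=1..Nx M. \<Sum>j=1..Nv M. vol i j)
      + (\<Sum>i=1..Nx M. \<Sum>j=1..Nv M. Fx i j - Fx (i - 1) j)
      - (\<Sum>i=1..Nx M. \<Sum>j=1..Nv M. Fv i j - Fv i (j - 1))"
    by (simp only: sum.distrib sum_subtractf)
  also have "(\<Sum>i=1..Nx M. \<Sum>j=1..Nv M. Fx i j - Fx (i - 1) j)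
      = (\<Sum>j=1..Nv M. \<Sum>i=1..Nx M. Fx i j - Fx (i - 1) j)"
    by (rule sum.swap)
  finally show ?thesis by (simp only: Fx Fv vol_def sum.neutral_const cong: sum.cong)
qed

text \<open>
  The scheme tested with \<open>v\<^sup>2 / 2\<close>, which is globally continuous and independent of \<open>x\<close>, so
  that of the volume terms only acceleration survives: the work done by the field.
\<close>

lemma kinetic_energy_balance:
  assumes mesh: "valid_mesh M" and per: "\<And>x v. g (x + len M) v = g x v"
    and van: "vanishes_at_vmax M g"
    and scheme: "\<And>i j. i \<in> {1..Nx M} \<Longrightarrow> j \<in> {1..Nv M} \<Longrightarrow> dg_form M g g' (\<lambda>x v. v\<^sup>2 / 2) i j = 0"
  shows "1 / 2 * (\<Sum>i=1..Nx M. \<Sum>j=1..Nv M. integral (cellI M i j) (\<lambda>(x, v). g' x v * v\<^sup>2))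
       = - (\<Sum>i=1..Nx M. \<Sum>j=1..Nv M. integral (cellI M i j) (\<lambda>(x, v). efield M g x * g x v * v))"
proof -
  let ?\<phi> = "\<lambda>x v :: real. v\<^sup>2 / 2"
  have Lim_const: "Lim (at_left b) (\<lambda>_. c) = c" "Lim (at_right b) (\<lambda>_. c) = c" for b c :: real
    by (auto intro!: tendsto_Lim)
  have v_trace: "((\<lambda>v. v\<^sup>2 / 2) \<longlongrightarrow> b\<^sup>2 / 2) (at b within A)" for b :: real and A
    by (intro tendsto_intros) auto
  have Lim_v: "Lim (at_left b) (\<lambda>v. v\<^sup>2 / 2) = b\<^sup>2 / 2" "Lim (at_right b) (\<lambda>v. v\<^sup>2 / 2) = b\<^sup>2 / 2"
    for b :: real
    by (rule tendsto_Lim[OF trivial_limit_at_left_real v_trace]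
          tendsto_Lim[OF trivial_limit_at_right_real v_trace])+
  have "0 = (\<Sum>i=1..Nx M. \<Sum>j=1..Nv M. dg_form M g g' ?\<phi> i j)"
    using scheme by simp
  also have "\<dots> = (\<Sum>i=1..Nx M. \<Sum>j=1..Nv M.
          integral (cellI M i j) (\<lambda>(x, v). g' x v * ?\<phi> x v)
        - integral (cellI M i j) (\<lambda>(x, v). v * g x v * deriv (\<lambda>y. ?\<phi> y v) x)
        + integral (cellI M i j) (\<lambda>(x, v). efield M g x * g x v * deriv (?\<phi> x) v))"
    by (rule sum_dg_form_continuous_test[where g = g and
          \<alpha> = "\<lambda>i v. v\<^sup>2 / 2" and \<beta> = "\<lambda>j x. (vn M j)\<^sup>2 / 2", OF mesh per van])
       (simp_all add: trace_x_minus_def trace_x_plus_def trace_v_minus_def trace_v_plus_def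
          Lim_const Lim_v)
  also have "\<dots> = (\<Sum>i=1..Nx M. \<Sum>j=1..Nv M.
          1 / 2 * integral (cellI M i j) (\<lambda>(x, v). g' x v * v\<^sup>2)
        + integral (cellI M i j) (\<lambda>(x, v). efield M g x * g x v * v))"
  proof -
    have "deriv (\<lambda>v. v\<^sup>2 / 2) v = v" for v :: real
      by (rule DERIV_imp_deriv) (auto intro!: derivative_eq_intros)
    moreover have "integral A (\<lambda>(x, v). g' x v * (v\<^sup>2 / 2)) = integral A (\<lambda>(x, v). g' x v * v\<^sup>2) / 2" for A
      using integral_divide[of A "\<lambda>(x, v). g' x v * v\<^sup>2" 2]
      by (simp add: case_prod_unfold)
    ultimately show ?thesis by (simp add: case_prod_unfold)
  qed
  finally show ?thesis by (simp add: sum.distrib sum_distrib_left)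
qed

text \<open>
  The scheme tested with a broken function \<open>u\<close> of \<open>x\<close> whose traces at the nodes are those of a periodic
  function \<open>U\<close>. Applied with \<open>u = P \<Phi>\<^sub>h\<close> and \<open>U = \<Phi>\<^sub>h\<close> it says \<open>A (f\<^sub>h, P \<Phi>\<^sub>h) = 0\<close>.
\<close>

lemma x_test_function_balance:
  assumes mesh: "valid_mesh M" and per: "\<And>x v. g (x + len M) v = g x v"
    and van: "vanishes_at_vmax M g"
    and nodes: "agrees_at_nodes M u U" and ends: "U (len M) = U 0"
    and scheme: "\<And>i j. i \<in> {1..Nx M} \<Longrightarrow> j \<in> {1..Nv M} \<Longrightarrow> dg_form M g g' (\<lambda>x v. u x) i j = 0"
  shows "(\<Sum>i=1..Nx M. \<Sum>j=1..Nv M. integral (cellI M i j) (\<lambda>(x, v). v * g x v * deriv u x)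
          - integral (cellI M i j) (\<lambda>(x, v). g' x v * u x)) = 0"
proof -
  let ?\<phi> = "\<lambda>x v :: real. u x"
  have "0 = (\<Sum>i=1..Nx M. \<Sum>j=1..Nv M. dg_form M g g' ?\<phi> i j)"
    using scheme by simp
  also have "\<dots> = (\<Sum>i=1..Nx M. \<Sum>j=1..Nv M.
          integral (cellI M i j) (\<lambda>(x, v). g' x v * ?\<phi> x v)
        - integral (cellI M i j) (\<lambda>(x, v). v * g x v * deriv (\<lambda>y. ?\<phi> y v) x)
        + integral (cellI M i j) (\<lambda>(x, v). efield M g x * g x v * deriv (?\<phi> x) v))"
    by (rule sum_dg_form_continuous_test[where g = g and
          \<alpha> = "\<lambda>i v. U (xn M i)" and \<beta> = "\<lambda>j x. u x", OF mesh per van])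
       (use nodes ends in \<open>auto simp: trace_x_minus_def trace_x_plus_def trace_v_minus_def
          trace_v_plus_def agrees_at_nodes_def xn_0[OF mesh] xn_Nx[OF mesh] intro!: tendsto_Lim\<close>)
  also have "\<dots> = - (\<Sum>i=1..Nx M. \<Sum>j=1..Nv M. integral (cellI M i j) (\<lambda>(x, v). v * g x v * deriv u x)
          - integral (cellI M i j) (\<lambda>(x, v). g' x v * u x))"
    by (simp add: case_prod_unfold sum_negf[symmetric])
  finally show ?thesis by simp
qed

section \<open>Bilinearity of the operator A\<close>

text \<open>
  The class of second arguments of the operator \<open>A\<close>: it contains the potential (with
  \<open>U' = - E\<^sub>h\<close>) and the broken polynomials, and is closed under differences. The function itself may have
  any values at the nodes.
\<close>

definition piecewise_C1 :: "dg_mesh \<Rightarrow> (real \<Rightarrow> real) \<Rightarrow> bool" where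
  "piecewise_C1 M u \<longleftrightarrow> (\<forall>i\<in>{1..Nx M}. \<exists>U U'. continuous_on (cellJ M i) U \<and>
     continuous_on (cellJ M i) U' \<and>
     (\<forall>x\<in>interior (cellJ M i). u x = U x \<and> (u has_real_derivative U' x) (at x)))"

lemma piecewise_C1_diff:
  assumes "piecewise_C1 M u" "piecewise_C1 M w"
  shows "piecewise_C1 M (\<lambda>x. u x - w x)"
  unfolding piecewise_C1_def
proof
  fix i assume i: "i \<in> {1..Nx M}"
  obtain U U' where U: "continuous_on (cellJ M i) U" "continuous_on (cellJ M i) U'"
     "\<forall>x\<in>interior (cellJ M i). u x = U x \<and> (u has_real_derivative U' x) (at x)"
    using assms(1) i unfolding piecewise_C1_def by blast
  obtain W W' where W: "continuous_on (cellJ M i) W" "continuous_on (cellJ M i) W'"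
     "\<forall>x\<in>interior (cellJ M i). w x = W x \<and> (w has_real_derivative W' x) (at x)"
    using assms(2) i unfolding piecewise_C1_def by blast
  show "\<exists>U U'. continuous_on (cellJ M i) U \<and> continuous_on (cellJ M i) U' \<and>
     (\<forall>x\<in>interior (cellJ M i). u x - w x = U x \<and>
        ((\<lambda>x. u x - w x) has_real_derivative U' x) (at x))"
    using U W by (intro exI[of _ "\<lambda>x. U x - W x"] exI[of _ "\<lambda>x. U' x - W' x"])
      (auto intro!: continuous_intros derivative_intros)
qed

lemma Z_space_piecewise_C1:
  assumes "u \<in> Z_space M l"
  shows "piecewise_C1 M u"
  unfolding piecewise_C1_def
proof
  fix i assume "i \<in> {1..Nx M}"
  then obtain p :: "real poly" where p: "\<And>x. x \<in> interior (cellJ M i) \<Longrightarrow> u x = poly p x"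
    using assms unfolding Z_space_def by blast
  have "(u has_real_derivative poly (pderiv p) x) (at x)" if "x \<in> interior (cellJ M i)" for x
    by (rule has_field_derivative_transform_within_open[OF poly_DERIV open_interior that])
       (simp add: p)
  then show "\<exists>U U'. continuous_on (cellJ M i) U \<and> continuous_on (cellJ M i) U' \<and>
     (\<forall>x\<in>interior (cellJ M i). u x = U x \<and> (u has_real_derivative U' x) (at x))"
    using p by (intro exI[of _ "poly p"] exI[of _ "poly (pderiv p)"])
      (auto intro!: continuous_intros)
qed

lemma potential_piecewise_C1:
  assumes mesh: "valid_mesh M" and g: "cellwise_continuous M g"
  shows "piecewise_C1 M (potential M g)"
  unfolding piecewise_C1_def
proof
  fix i assume i: "i \<in> {1..Nx M}"
  have "continuous_on (cellJ M i) (potential M g)" "continuous_on (cellJ M i) (\<lambda>x. - efield M g x)"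
    using continuous_on_subset[OF _ cellJ_subset[OF mesh i]] potential_continuous[OF mesh g]
      efield_continuous[OF mesh g] by (auto intro!: continuous_intros)
  then show "\<exists>U U'. continuous_on (cellJ M i) U \<and> continuous_on (cellJ M i) U' \<and>
     (\<forall>x\<in>interior (cellJ M i). potential M g x = U x \<and>
        (potential M g has_real_derivative U' x) (at x))"
    using potential_has_derivative[OF mesh g] interior_cellJ_subset[OF mesh i]
    by (intro exI[of _ "potential M g"] exI[of _ "\<lambda>x. - efield M g x"]) auto
qed

lemma A_integrands_integrable:
  assumes w: "cellwise_continuous M w" and w': "cellwise_continuous M w'"
    and u: "piecewise_C1 M u" and ij: "i \<in> {1..Nx M}" "j \<in> {1..Nv M}"
  shows "(\<lambda>(x, v). w x v * deriv u x * v) integrable_on cellI M i j"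
    and "(\<lambda>(x, v). w' x v * u x) integrable_on cellI M i j"
proof -
  obtain U U' where U: "continuous_on (cellJ M i) U" "continuous_on (cellJ M i) U'"
     "\<forall>x\<in>interior (cellJ M i). u x = U x \<and> (u has_real_derivative U' x) (at x)"
    using u ij unfolding piecewise_C1_def by blast
  have fst: "continuous_on (cellI M i j) (\<lambda>p. H (fst p))" if "continuous_on (cellJ M i) H"
    for H :: "real \<Rightarrow> real"
    by (rule continuous_on_compose2[OF that]) (auto simp: cellI_def intro!: continuous_intros)
  have "(\<lambda>(x, v). w x v * (U' x * v)) integrable_on cellI M i j"
    by (rule cellwise_continuous_times_integrable[OF w ij])
       (auto simp: case_prod_beta intro!: continuous_intros fst U)
  then have "((\<lambda>(x, v). w x v * deriv u x * v) has_integral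
     integral (cellI M i j) (\<lambda>(x, v). w x v * (U' x * v))) (cellI M i j)"
    by (rule has_integral_cell_spike[OF integrable_integral]) (use U(3) DERIV_imp_deriv in fastforce)
  then show "(\<lambda>(x, v). w x v * deriv u x * v) integrable_on cellI M i j" by blast
  have "(\<lambda>(x, v). w' x v * U x) integrable_on cellI M i j"
    by (rule cellwise_continuous_times_integrable[OF w' ij])
       (auto simp: case_prod_beta intro!: continuous_intros fst U)
  then have "((\<lambda>(x, v). w' x v * u x) has_integral
     integral (cellI M i j) (\<lambda>(x, v). w' x v * U x)) (cellI M i j)"
    by (rule has_integral_cell_spike[OF integrable_integral]) (use U(3) in auto)
  then show "(\<lambda>(x, v). w' x v * u x) integrable_on cellI M i j" by blast
qed

text \<open>
  The operator \<open>A\<close> at a fixed time. The time derivative of the first argument is a separate argument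
  \<open>w'\<close>, which makes this expression bilinear in \<open>(w, w')\<close> and \<open>u\<close> without reference to time.
\<close>

definition A_form ::
  "dg_mesh \<Rightarrow> (real \<Rightarrow> real \<Rightarrow> real) \<Rightarrow> (real \<Rightarrow> real \<Rightarrow> real) \<Rightarrow> (real \<Rightarrow> real) \<Rightarrow> real" where
  "A_form M w w' u = (\<Sum>i=1..Nx M. \<Sum>j=1..Nv M.
     integral (cellI M i j) (\<lambda>(x, v). w x v * deriv u x * v - w' x v * u x))"

lemma A_op_eq_A_form: "A_op M T t w u = A_form M (w t) (time_deriv T w t) u"
  by (simp add: A_op_def A_form_def)

lemma A_form_split:
  assumes "cellwise_continuous M w" "cellwise_continuous M w'" "piecewise_C1 M u"
  shows "A_form M w w' u = (\<Sum>i=1..Nx M. \<Sum>j=1..Nv M.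
     integral (cellI M i j) (\<lambda>(x, v). w x v * deriv u x * v)
     - integral (cellI M i j) (\<lambda>(x, v). w' x v * u x))"
  unfolding A_form_def
proof (intro sum.cong refl)
  fix i j assume ij: "i \<in> {1..Nx M}" "j \<in> {1..Nv M}"
  show "integral (cellI M i j) (\<lambda>(x, v). w x v * deriv u x * v - w' x v * u x)
     = integral (cellI M i j) (\<lambda>(x, v). w x v * deriv u x * v)
     - integral (cellI M i j) (\<lambda>(x, v). w' x v * u x)"
    using integral_diff[OF A_integrands_integrable[OF assms ij]] by (simp add: case_prod_unfold)
qed

lemma A_integrand_has_integral:
  assumes "cellwise_continuous M w" "cellwise_continuous M w'" "piecewise_C1 M u"
    and "i \<in> {1..Nx M}" "j \<in> {1..Nv M}"
  shows "((\<lambda>(x, v). w x v * deriv u x * v - w' x v * u x) has_integral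
      integral (cellI M i j) (\<lambda>(x, v). w x v * deriv u x * v - w' x v * u x)) (cellI M i j)"
  using integrable_diff[OF A_integrands_integrable[OF assms]]
  by (simp add: case_prod_unfold integrable_integral)

lemma A_form_diff_left:
  assumes w: "cellwise_continuous M w1" "cellwise_continuous M w1'"
      "cellwise_continuous M w2" "cellwise_continuous M w2'" and u: "piecewise_C1 M u"
    and w': "\<And>i j x v. i \<in> {1..Nx M} \<Longrightarrow> j \<in> {1..Nv M} \<Longrightarrow> x \<in> interior (cellJ M i) \<Longrightarrow>
        v \<in> interior (cellK M j) \<Longrightarrow> w' x v = w1' x v - w2' x v"
  shows "A_form M (\<lambda>x v. w1 x v - w2 x v) w' u = A_form M w1 w1' u - A_form M w2 w2' u"
  unfolding A_form_def sum_subtractf[symmetric]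
proof (intro sum.cong refl)
  fix i j assume ij: "i \<in> {1..Nx M}" "j \<in> {1..Nv M}"
  have "((\<lambda>(x, v). (w1 x v * deriv u x * v - w1' x v * u x) - (w2 x v * deriv u x * v - w2' x v * u x))
      has_integral
        integral (cellI M i j) (\<lambda>(x, v). w1 x v * deriv u x * v - w1' x v * u x)
      - integral (cellI M i j) (\<lambda>(x, v). w2 x v * deriv u x * v - w2' x v * u x)) (cellI M i j)"
    using has_integral_diff[OF A_integrand_has_integral[OF w(1,2) u ij]
        A_integrand_has_integral[OF w(3,4) u ij]] by (simp add: case_prod_unfold)
  then have "((\<lambda>(x, v). (w1 x v - w2 x v) * deriv u x * v - w' x v * u x) has_integral
        integral (cellI M i j) (\<lambda>(x, v). w1 x v * deriv u x * v - w1' x v * u x)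
      - integral (cellI M i j) (\<lambda>(x, v). w2 x v * deriv u x * v - w2' x v * u x)) (cellI M i j)"
    by (rule has_integral_cell_spike) (simp add: w'[OF ij] algebra_simps)
  then show "integral (cellI M i j) (\<lambda>(x, v). (w1 x v - w2 x v) * deriv u x * v - w' x v * u x)
      = integral (cellI M i j) (\<lambda>(x, v). w1 x v * deriv u x * v - w1' x v * u x)
      - integral (cellI M i j) (\<lambda>(x, v). w2 x v * deriv u x * v - w2' x v * u x)"
    by (rule integral_unique)
qed

lemma piecewise_C1_deriv_diff:
  assumes "piecewise_C1 M u" "piecewise_C1 M w" "i \<in> {1..Nx M}" "x \<in> interior (cellJ M i)"
  shows "deriv (\<lambda>x. u x - w x) x = deriv u x - deriv w x"
proof -
  have "\<exists>d. (u has_real_derivative d) (at x)" "\<exists>d. (w has_real_derivative d) (at x)"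
    using assms unfolding piecewise_C1_def by blast+
  then show ?thesis
    by (intro deriv_diff) (auto simp: field_differentiable_def)
qed

lemma A_form_diff_right:
  assumes w: "cellwise_continuous M w" "cellwise_continuous M w'"
    and u: "piecewise_C1 M u1" "piecewise_C1 M u2"
  shows "A_form M w w' (\<lambda>x. u1 x - u2 x) = A_form M w w' u1 - A_form M w w' u2"
  unfolding A_form_def sum_subtractf[symmetric]
proof (intro sum.cong refl)
  fix i j assume ij: "i \<in> {1..Nx M}" "j \<in> {1..Nv M}"
  have "((\<lambda>(x, v). (w x v * deriv u1 x * v - w' x v * u1 x) - (w x v * deriv u2 x * v - w' x v * u2 x))
      has_integral
        integral (cellI M i j) (\<lambda>(x, v). w x v * deriv u1 x * v - w' x v * u1 x)
      - integral (cellI M i j) (\<lambda>(x, v). w x v * deriv u2 x * v - w' x v * u2 x)) (cellI M i j)"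
    using has_integral_diff[OF A_integrand_has_integral[OF w u(1) ij]
        A_integrand_has_integral[OF w u(2) ij]] by (simp add: case_prod_unfold)
  then have "((\<lambda>(x, v). w x v * deriv (\<lambda>x. u1 x - u2 x) x * v - w' x v * (u1 x - u2 x)) has_integral
        integral (cellI M i j) (\<lambda>(x, v). w x v * deriv u1 x * v - w' x v * u1 x)
      - integral (cellI M i j) (\<lambda>(x, v). w x v * deriv u2 x * v - w' x v * u2 x)) (cellI M i j)"
    by (rule has_integral_cell_spike) (simp add: piecewise_C1_deriv_diff[OF u ij(1)] algebra_simps)
  then show "integral (cellI M i j) (\<lambda>(x, v). w x v * deriv (\<lambda>x. u1 x - u2 x) x * v - w' x v * (u1 x - u2 x))
      = integral (cellI M i j) (\<lambda>(x, v). w x v * deriv u1 x * v - w' x v * u1 x)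
      - integral (cellI M i j) (\<lambda>(x, v). w x v * deriv u2 x * v - w' x v * u2 x)"
    by (rule integral_unique)
qed

text \<open>
  Since \<open>\<Phi>\<^sub>x = - E\<close>, the two summands are the rates of change of the kinetic energy and of the field
  energy.
\<close>

lemma A_form_potential:
  assumes mesh: "valid_mesh M" and w: "cellwise_continuous M w" "cellwise_continuous M w'"
  shows "A_form M w w' (potential M w) =
     - (\<Sum>i=1..Nx M. \<Sum>j=1..Nv M. integral (cellI M i j) (\<lambda>(x, v). efield M w x * w x v * v))
     - integral {0..len M} (\<lambda>x. charge_density M w' x * potential M w x)"
proof -
  have cell: "integral (cellI M i j) (\<lambda>(x, v). w x v * deriv (potential M w) x * v)
      = - integral (cellI M i j) (\<lambda>(x, v). efield M w x * w x v * v)"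
    if ij: "i \<in> {1..Nx M}" "j \<in> {1..Nv M}" for i j
  proof -
    have D: "deriv (potential M w) x = - efield M w x" if "x \<in> interior (cellJ M i)" for x
      using potential_has_derivative[OF mesh w(1)] interior_cellJ_subset[OF mesh ij(1)] that
      by (intro DERIV_imp_deriv) auto
    have "((\<lambda>(x, v). efield M w x * w x v * v) has_integral
        - integral (cellI M i j) (\<lambda>(x, v). w x v * deriv (potential M w) x * v)) (cellI M i j)"
    proof (rule has_integral_cell_spike)
      show "((\<lambda>(x, v). - (w x v * deriv (potential M w) x * v)) has_integral
        - integral (cellI M i j) (\<lambda>(x, v). w x v * deriv (potential M w) x * v)) (cellI M i j)"
        using has_integral_neg[OF integrable_integral[OF A_integrands_integrable(1)[OF w
            potential_piecewise_C1[OF mesh w(1)] ij]]] by (simp add: case_prod_unfold)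
    qed (simp add: D)
    then show ?thesis by (simp add: integral_unique)
  qed
  have "(\<Sum>i=1..Nx M. \<Sum>j=1..Nv M. integral (cellI M i j) (\<lambda>(x, v). w x v * deriv (potential M w) x * v))
     = (\<Sum>i=1..Nx M. \<Sum>j=1..Nv M. - integral (cellI M i j) (\<lambda>(x, v). efield M w x * w x v * v))"
    by (intro sum.cong refl cell)
  then show ?thesis
    using sum_cell_integral_eq_charge_density[OF mesh w(2) potential_continuous[OF mesh w(1)]]
    unfolding A_form_split[OF w potential_piecewise_C1[OF mesh w(1)]]
    by (simp add: sum_subtractf sum_negf)
qed

section \<open>The exact solution\<close>

text \<open>
  The Vlasov equation integrated over one cell against a function \<open>U\<close> of \<open>x\<close>. The terms with \<open>v\<close> combine to
  \<open>v (F U)\<^sub>x\<close>, whose integral in \<open>x\<close> vanishes because \<open>U\<close> does at both ends; the acceleration term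
  integrates in \<open>v\<close> to the difference of the fluxes through the two \<open>v\<close>-faces.
\<close>

lemma integral_transport_cell:
  fixes F Fx Fv :: "real \<Rightarrow> real \<Rightarrow> real"
  assumes ab: "a \<le> b" and cd: "c \<le> d"
    and F: "continuous_on ({a..b} \<times> {c..d}) (\<lambda>(x, v). F x v)"
    and Fx: "continuous_on ({a..b} \<times> {c..d}) (\<lambda>(x, v). Fx x v)"
    and Fv: "continuous_on ({a..b} \<times> {c..d}) (\<lambda>(x, v). Fv x v)"
    and dFx: "\<And>x v. ((\<lambda>y. F y v) has_real_derivative Fx x v) (at x)"
    and dFv: "\<And>x v. (F x has_real_derivative Fv x v) (at v)"
    and U: "continuous_on {a..b} U" and U': "continuous_on {a..b} U'"
    and dU: "\<And>x. x \<in> {a<..<b} \<Longrightarrow> (U has_real_derivative U' x) (at x)"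
    and e: "continuous_on {a..b} e" and ends: "U a = 0" "U b = 0"
  shows "integral {a..b} (\<lambda>x. integral {c..d} (\<lambda>v. F x v * U' x * v - (e x * Fv x v - v * Fx x v) * U x))
     = integral {a..b} (\<lambda>x. e x * U x * F x c) - integral {a..b} (\<lambda>x. e x * U x * F x d)"
proof -
  have fst: "continuous_on ({a..b} \<times> {c..d}) (\<lambda>p. H (fst p))" if "continuous_on {a..b} H"
    for H :: "real \<Rightarrow> real"
    by (rule continuous_on_compose2[OF that]) (auto intro!: continuous_intros)
  note cont = F[unfolded case_prod_unfold] Fx[unfolded case_prod_unfold]
    Fv[unfolded case_prod_unfold] fst[OF U] fst[OF U'] fst[OF e]
  \<comment> \<open>\<open>H\<close> is \<open>v (F U)\<^sub>x\<close> and \<open>G\<close> is \<open>(e F U)\<^sub>v\<close>; each is integrated first in its own direction.\<close>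
  define H where "H x v = v * (F x v * U' x + Fx x v * U x)" for x v
  define G where "G x v = e x * U x * Fv x v" for x v
  have H: "continuous_on ({a..b} \<times> {c..d}) (\<lambda>(x, v). H x v)"
    unfolding H_def case_prod_unfold by (intro continuous_intros cont)
  have G: "continuous_on ({a..b} \<times> {c..d}) (\<lambda>(x, v). G x v)"
    unfolding G_def case_prod_unfold by (intro continuous_intros cont)
  have Hx: "integral {a..b} (\<lambda>x. H x v) = 0" if v: "v \<in> {c..d}" for v
  proof -
    have "((\<lambda>x. H x v) has_integral (v * (F b v * U b) - v * (F a v * U a))) {a..b}"
    proof (rule fundamental_theorem_of_calculus_interior[OF ab])
      show "continuous_on {a..b} (\<lambda>x. v * (F x v * U x))"
        using continuous_on_fst_section[OF F v] U by (intro continuous_intros)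
      show "((\<lambda>x. v * (F x v * U x)) has_vector_derivative H x v) (at x)" if "x \<in> {a<..<b}" for x
        unfolding has_real_derivative_iff_has_vector_derivative[symmetric] H_def
        by (auto intro!: derivative_eq_intros dFx dU[OF that])
    qed
    then show ?thesis by (simp add: ends integral_unique)
  qed
  have "integral {a..b} (\<lambda>x. integral {c..d} (H x)) = integral {c..d} (\<lambda>v. integral {a..b} (\<lambda>x. H x v))"
    using integral_swap_continuous[of a c b d H] H by (simp add: cbox_Pair_eq)
  also have "\<dots> = integral {c..d} (\<lambda>v. 0)"
    by (intro integral_cong Hx)
  finally have H0: "integral {a..b} (\<lambda>x. integral {c..d} (H x)) = 0" by simp
  have Gv: "integral {c..d} (G x) = e x * U x * F x d - e x * U x * F x c" for x
  proof -
    have "(G x has_integral (e x * U x * F x d - e x * U x * F x c)) {c..d}"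
      unfolding G_def
      by (rule fundamental_theorem_of_calculus[OF cd])
         (auto simp: has_real_derivative_iff_has_vector_derivative[symmetric]
           intro!: derivative_eq_intros DERIV_subset[OF dFv])
    then show ?thesis by (rule integral_unique)
  qed
  have "(\<lambda>v. F x v * U' x * v - (e x * Fv x v - v * Fx x v) * U x) = (\<lambda>v. H x v - G x v)" for x
    by (auto simp: H_def G_def algebra_simps)
  then have "integral {a..b} (\<lambda>x. integral {c..d} (\<lambda>v. F x v * U' x * v - (e x * Fv x v - v * Fx x v) * U x))
     = integral {a..b} (\<lambda>x. integral {c..d} (\<lambda>v. H x v - G x v))"
    by simp
  also have "\<dots> = integral {a..b} (\<lambda>x. integral {c..d} (H x) - integral {c..d} (G x))"
    by (intro integral_cong integral_diff integrable_continuous_real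
        continuous_on_snd_section[OF H] continuous_on_snd_section[OF G])
  also have "\<dots> = integral {a..b} (\<lambda>x. integral {c..d} (H x)) - integral {a..b} (\<lambda>x. integral {c..d} (G x))"
  proof (intro integral_diff integrable_continuous_real)
    show "continuous_on {a..b} (\<lambda>x. integral {c..d} (H x))"
      using integral_continuous_on_param[of "{a..b}" c d H] H by simp
    show "continuous_on {a..b} (\<lambda>x. integral {c..d} (G x))"
      using integral_continuous_on_param[of "{a..b}" c d G] G by simp
  qed
  also have "\<dots> = - integral {a..b} (\<lambda>x. e x * U x * F x d - e x * U x * F x c)"
    by (simp add: H0 Gv)
  also have "integral {a..b} (\<lambda>x. e x * U x * F x d - e x * U x * F x c)
     = integral {a..b} (\<lambda>x. e x * U x * F x d) - integral {a..b} (\<lambda>x. e x * U x * F x c)"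
    using continuous_on_fst_section[OF F, of c] continuous_on_fst_section[OF F, of d] cd
    by (intro integral_diff integrable_continuous_real continuous_intros U e) auto
  finally show ?thesis by simp
qed

text \<open>
  Translates traces of a broken function into end point values of its continuous extension.
\<close>

lemma one_sided_limits_of_extension:
  fixes u U :: "real \<Rightarrow> real"
  assumes ab: "a < b" and U: "continuous_on {a..b} U"
    and eq: "\<And>x. x \<in> {a<..<b} \<Longrightarrow> u x = U x"
    and lim: "(u \<longlongrightarrow> y) (at_right a)" "(u \<longlongrightarrow> z) (at_left b)"
  shows "U a = y" "U b = z"
proof -
  have "(U \<longlongrightarrow> U a) (at a within {a..b})" "(U \<longlongrightarrow> U b) (at b within {a..b})"
    using U ab by (simp_all add: continuous_on_def)
  then have "(U \<longlongrightarrow> U a) (at_right a)" "(U \<longlongrightarrow> U b) (at_left b)"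
    using ab by (simp_all add: at_within_Icc_at_right at_within_Icc_at_left)
  moreover have "\<forall>\<^sub>F x in at_right a. u x = U x"
    using eventually_at_right_real[OF ab] by eventually_elim (rule eq)
  moreover have "\<forall>\<^sub>F x in at_left b. u x = U x"
    using eventually_at_left_real[OF ab] by eventually_elim (rule eq)
  ultimately have "(u \<longlongrightarrow> U a) (at_right a)" "(u \<longlongrightarrow> U b) (at_left b)"
    by (simp_all add: tendsto_cong)
  then show "U a = y" "U b = z"
    using lim by (auto intro: tendsto_unique[rotated])
qed

lemma continuous_imp_cellwise_continuous:
  "continuous_on UNIV (\<lambda>(x, v). g x v) \<Longrightarrow> cellwise_continuous M g"
  unfolding cellwise_continuous_def using continuous_on_subset by blast

text \<open>
  On a column of cells over one \<open>x\<close>-interval, the fluxes through the \<open>v\<close>-faces that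
  \<open>integral_transport_cell\<close> leaves telescope to \<open>v = \<plusminus>V\<^sub>c\<close>, where the exact solution vanishes.
\<close>

lemma A_form_exact_solution:
  assumes mesh: "valid_mesh M"
    and F: "continuous_on UNIV (\<lambda>(x, v). F x v)"
    and Fx: "continuous_on UNIV (\<lambda>(x, v). Fx x v)"
    and Fv: "continuous_on UNIV (\<lambda>(x, v). Fv x v)"
    and dFx: "\<And>x v. ((\<lambda>y. F y v) has_real_derivative Fx x v) (at x)"
    and dFv: "\<And>x v. (F x has_real_derivative Fv x v) (at v)"
    and vlasov: "\<And>x v. Ft x v = e x * Fv x v - v * Fx x v"
    and e: "continuous_on UNIV e"
    and supp: "\<And>x v. \<bar>v\<bar> = vmax M \<Longrightarrow> F x v = 0"
    and u: "piecewise_C1 M u"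
    and nodes: "\<And>i. i \<in> {1..Nx M} \<Longrightarrow> (u \<longlongrightarrow> 0) (at_right (xn M (i - 1))) \<and> (u \<longlongrightarrow> 0) (at_left (xn M i))"
  shows "A_form M F Ft u = 0"
  unfolding A_form_def
proof (rule sum.neutral, rule ballI)
  fix i assume i: "i \<in> {1..Nx M}"
  let ?a = "xn M (i - 1)" and ?b = "xn M i"
  obtain U U' where U: "continuous_on {?a..?b} U" "continuous_on {?a..?b} U'"
    and uU: "\<And>x. x \<in> interior (cellJ M i) \<Longrightarrow> u x = U x"
    and uU': "\<And>x. x \<in> interior (cellJ M i) \<Longrightarrow> (u has_real_derivative U' x) (at x)"
    using u i unfolding piecewise_C1_def cellJ_def by blast
  have ab: "?a < ?b" by (rule xn_step[OF mesh i])
  have ends: "U ?a = 0" "U ?b = 0"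
    using one_sided_limits_of_extension[OF ab U(1) uU] nodes[OF i] by (auto simp: interior_cellJ)
  have dU: "(U has_real_derivative U' x) (at x)" if "x \<in> {?a<..<?b}" for x
  proof -
    have "x \<in> interior (cellJ M i)" using that by (simp add: interior_cellJ)
    from has_field_derivative_transform_within_open[OF uU'[OF this] open_interior this uU]
    show ?thesis .
  qed
  define \<Psi> where "\<Psi> j = integral {?a..?b} (\<lambda>x. e x * U x * F x (vn M j))" for j
  have cell: "integral (cellI M i j) (\<lambda>(x, v). F x v * deriv u x * v - Ft x v * u x)
      = - (\<Psi> j - \<Psi> (j - 1))" if j: "j \<in> {1..Nv M}" for j
  proof -
    let ?H = "\<lambda>x v. F x v * U' x * v - (e x * Fv x v - v * Fx x v) * U x"
    have fst: "continuous_on (cellI M i j) (\<lambda>p. h (fst p))" if "continuous_on {?a..?b} h"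
      for h :: "real \<Rightarrow> real"
      by (rule continuous_on_compose2[OF that])
         (auto simp: cellI_def cellJ_def intro!: continuous_intros)
    have sub: "continuous_on A (\<lambda>p. h (fst p) (snd p))" if "continuous_on UNIV (\<lambda>(x, v). h x v)"
      for h :: "real \<Rightarrow> real \<Rightarrow> real" and A
      using continuous_on_subset[OF that subset_UNIV] by (simp add: case_prod_unfold)
    have e': "continuous_on {?a..?b} e" using continuous_on_subset[OF e] by blast
    have "continuous_on (cellI M i j) (\<lambda>(x, v). ?H x v)"
      unfolding case_prod_unfold
      by (intro continuous_intros sub[OF F] sub[OF Fx] sub[OF Fv] fst U e')
    then have "((\<lambda>(x, v). F x v * deriv u x * v - Ft x v * u x) has_integral
        integral (cellJ M i) (\<lambda>x. integral (cellK M j) (?H x))) (cellI M i j)"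
      by (rule cell_has_integral) (simp add: uU DERIV_imp_deriv[OF uU'] vlasov)
    then have "integral (cellI M i j) (\<lambda>(x, v). F x v * deriv u x * v - Ft x v * u x)
      = integral (cellJ M i) (\<lambda>x. integral (cellK M j) (?H x))"
      by (rule integral_unique)
    also have "\<dots> = \<Psi> (j - 1) - \<Psi> j"
      unfolding cellJ_def cellK_def \<Psi>_def
      by (rule integral_transport_cell)
         (use ab vn_step[OF mesh j] dFx dFv U dU e' ends F Fx Fv
          in \<open>auto intro: continuous_on_subset\<close>)
    finally show ?thesis by simp
  qed
  have "\<Psi> 0 = 0" "\<Psi> (Nv M) = 0"
    unfolding \<Psi>_def using supp vn_step[OF mesh] strict_mono_on_leD[OF vn_mono[OF mesh], of 0 "Nv M"]
    by (simp_all add: vn_0[OF mesh] vn_Nv[OF mesh])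
  moreover have "(\<Sum>j=1..Nv M. \<Psi> j - \<Psi> (j - 1)) = \<Psi> (Nv M) - \<Psi> 0"
    using sum_telescope''[of 0 "Nv M" \<Psi>] by simp
  ultimately have "(\<Sum>j=1..Nv M. \<Psi> j - \<Psi> (j - 1)) = 0" by simp
  moreover have "(\<Sum>j=1..Nv M. integral (cellI M i j) (\<lambda>(x, v). F x v * deriv u x * v - Ft x v * u x))
    = (\<Sum>j=1..Nv M. - (\<Psi> j - \<Psi> (j - 1)))"
    by (intro sum.cong refl cell)
  ultimately show "(\<Sum>j=1..Nv M. integral (cellI M i j) (\<lambda>(x, v). F x v * deriv u x * v - Ft x v * u x)) = 0"
    by (simp only: sum_negf)
qed

section \<open>The energy identity\<close>

theorem proposition4:
  fixes M :: dg_mesh and l :: nat and S :: "(real \<Rightarrow> real \<Rightarrow> real) set"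
    and T t :: real
    and fh f :: "real \<Rightarrow> real \<Rightarrow> real \<Rightarrow> real"
    and \<Phi> E :: "real \<Rightarrow> real \<Rightarrow> real"
    and D :: "(real \<Rightarrow> real) set" and P :: "(real \<Rightarrow> real) \<Rightarrow> real \<Rightarrow> real"
  assumes mesh: "valid_mesh M"
    and l: "l \<ge> 2"
    and S: "S = V_space M l \<or> S = W_space M l"
    and T: "T > 0"
    and scheme: "semidiscrete_solution M S T fh"
    and neutral: "integral {0..len M} (charge_density M (fh 0)) = len M"
    and bc: "\<And>s. s \<in> {0..T} \<Longrightarrow> vanishes_at_vmax M (fh s)"
    and exact: "vlasov_poisson_solution (len M) T f \<Phi> E"
    and exact_supp: "\<And>s x v. s \<in> {0..T} \<Longrightarrow> \<bar>v\<bar> \<ge> vmax M \<Longrightarrow> f s x v = 0"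
    and t: "t \<in> {0..T}"
    and proj: "projection_on D P" "potential M (fh t) \<in> D"
    and proj_Z: "P (potential M (fh t)) \<in> Z_space M l"
    and proj_nodes: "agrees_at_nodes M (P (potential M (fh t))) (potential M (fh t))"
  shows "((\<lambda>s. energy M (fh s)) has_real_derivative
            A_op M T t fh (potential M (fh t))) (at t within {0..T}) \<and>
         A_op M T t fh (potential M (fh t)) =
         A_op M T t (\<lambda>s x v. fh s x v - f s x v)
           (\<lambda>x. potential M (fh t) x - P (potential M (fh t)) x)"
proof
  let ?g = "fh t" and ?g' = "time_deriv T fh t"
  let ?\<Phi> = "potential M (fh t)"
  let ?P = "P ?\<Phi>"
  have WS: "W_space M l \<subseteq> S" and SV: "S \<subseteq> V_space M l"
    using S W_space_subset_V_space by auto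
  have V: "fh s \<in> V_space M l" if "s \<in> {0..T}" for s
    using scheme that SV unfolding semidiscrete_solution_def by blast
  have per: "fh t (x + len M) v = fh t x v" for x v
    using scheme t unfolding semidiscrete_solution_def by blast
  have diff: "(\<lambda>s. fh s x v) differentiable (at t within {0..T})"
    if "i \<in> {1..Nx M}" "j \<in> {1..Nv M}" "x \<in> interior (cellJ M i)" "v \<in> interior (cellK M j)"
    for i j x v
    using scheme t that unfolding semidiscrete_solution_def by blast
  have form: "dg_form M ?g ?g' \<phi> i j = 0"
    if "\<phi> \<in> W_space M l" "i \<in> {1..Nx M}" "j \<in> {1..Nv M}" for \<phi> i j
    using scheme t that WS unfolding semidiscrete_solution_def by blast
  have g: "cellwise_continuous M ?g"
    by (rule V_space_cellwise_continuous[OF V[OF t]])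
  note en = energy_has_derivative[where fh = fh, OF mesh T t V diff]
  have g': "cellwise_continuous M ?g'" by (rule en(1))
  have \<Phi>: "piecewise_C1 M ?\<Phi>" by (rule potential_piecewise_C1[OF mesh g])
  have P: "piecewise_C1 M ?P" by (rule Z_space_piecewise_C1[OF proj_Z])

  have "1 / 2 * (\<Sum>i=1..Nx M. \<Sum>j=1..Nv M. integral (cellI M i j) (\<lambda>(x, v). ?g' x v * v\<^sup>2))
       = - (\<Sum>i=1..Nx M. \<Sum>j=1..Nv M. integral (cellI M i j) (\<lambda>(x, v). efield M ?g x * ?g x v * v))"
    by (rule kinetic_energy_balance[where g = ?g, OF mesh per bc[OF t] form[OF kinetic_weight_in_W_space[OF l]]])
  then show "((\<lambda>s. energy M (fh s)) has_real_derivative A_op M T t fh ?\<Phi>) (at t within {0..T})"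
    using en(2) unfolding A_op_eq_A_form A_form_potential[OF mesh g g']
    by (simp add: integral_efield_self_field[OF mesh g g'])

  \<comment> \<open>\<open>A (f\<^sub>h, P \<Phi>\<^sub>h) = 0\<close>: the scheme tested with the projected potential.\<close>
  have AP: "A_form M ?g ?g' ?P = 0"
  proof -
    have "(\<Sum>i=1..Nx M. \<Sum>j=1..Nv M. integral (cellI M i j) (\<lambda>(x, v). v * ?g x v * deriv ?P x)
          - integral (cellI M i j) (\<lambda>(x, v). ?g' x v * ?P x)) = 0"
      by (rule x_test_function_balance[where g = ?g, OF mesh per bc[OF t] proj_nodes _
            form[OF x_function_in_W_space[OF proj_Z]]])
         (simp add: potential_at_ends[OF mesh])
    then show ?thesis
      unfolding A_form_split[OF g g' P] by (simp add: mult_ac)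
  qed

  obtain ft fx fv where
    cft: "continuous_on ({0..T} \<times> UNIV) (\<lambda>(t, x, v). ft t x v)" and
    cfx: "continuous_on ({0..T} \<times> UNIV) (\<lambda>(t, x, v). fx t x v)" and
    cfv: "continuous_on ({0..T} \<times> UNIV) (\<lambda>(t, x, v). fv t x v)" and
    deriv_all: "\<forall>t\<in>{0..T}. \<forall>x v. ((\<lambda>s. f s x v) has_real_derivative ft t x v) (at t within {0..T}) \<and>
           ((\<lambda>y. f t y v) has_real_derivative fx t x v) (at x) \<and>
           (f t x has_real_derivative fv t x v) (at v) \<and>
           ft t x v + v * fx t x v - E t x * fv t x v = 0"
    using exact unfolding vlasov_poisson_solution_def by (elim conjE exE) (rule that)
  have deriv: "((\<lambda>s. f s x v) has_real_derivative ft t x v) (at t within {0..T})"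
    "((\<lambda>y. f t y v) has_real_derivative fx t x v) (at x)"
    "(f t x has_real_derivative fv t x v) (at v)"
    "ft t x v + v * fx t x v - E t x * fv t x v = 0" for x v
    using deriv_all t by auto
  have cf: "continuous_on ({0..T} \<times> UNIV) (\<lambda>(t, x, v). f t x v)"
    and cE: "continuous_on UNIV (E t)"
  proof -
    show "continuous_on ({0..T} \<times> UNIV) (\<lambda>(t, x, v). f t x v)"
      using exact unfolding vlasov_poisson_solution_def by (elim conjE)
    have "\<forall>t\<in>{0..T}. \<forall>x. (\<Phi> t has_real_derivative - E t x) (at x) \<and>
        (E t has_real_derivative 1 - integral UNIV (f t x)) (at x)"
      using exact unfolding vlasov_poisson_solution_def by (elim conjE)
    then show "continuous_on UNIV (E t)"
      using t by (auto intro!: DERIV_continuous_on)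
  qed
  have slice: "continuous_on UNIV (\<lambda>(x, v). h t x v)"
    if "continuous_on ({0..T} \<times> UNIV) (\<lambda>(t, x, v). h t x v)" for h :: "real \<Rightarrow> real \<Rightarrow> real \<Rightarrow> real"
  proof -
    have "continuous_on UNIV (\<lambda>p :: real \<times> real. case (t, p) of (t, x, v) \<Rightarrow> h t x v)"
      by (rule continuous_on_compose2[OF that]) (use t in \<open>auto intro!: continuous_intros\<close>)
    then show ?thesis by simp
  qed
  have f': "time_deriv T f t x v = ft t x v" for x v
    unfolding time_deriv_def using deriv(1)
    by (intro vector_derivative_within_closed_interval[OF T t])
       (simp add: has_real_derivative_iff_has_vector_derivative)
  have f: "cellwise_continuous M (f t)" "cellwise_continuous M (time_deriv T f t)"
    using slice[OF cf] slice[OF cft] by (auto simp: f' intro!: continuous_imp_cellwise_continuous)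
  \<comment> \<open>Restricted to open cells, since \<open>f\<^sub>h\<close> is not known to be differentiable in time on the interfaces.\<close>
  have diff': "time_deriv T (\<lambda>s x v. fh s x v - f s x v) t x v = ?g' x v - time_deriv T f t x v"
    if "i \<in> {1..Nx M}" "j \<in> {1..Nv M}" "x \<in> interior (cellJ M i)" "v \<in> interior (cellK M j)"
    for i j x v
  proof -
    have "((\<lambda>s. fh s x v) has_vector_derivative ?g' x v) (at t within {0..T})"
      using diff[OF that] by (simp add: time_deriv_def vector_derivative_works)
    moreover have "((\<lambda>s. f s x v) has_vector_derivative ft t x v) (at t within {0..T})"
      using deriv(1) by (simp add: has_real_derivative_iff_has_vector_derivative)
    ultimately have "((\<lambda>s. fh s x v - f s x v) has_vector_derivative ?g' x v - ft t x v)
        (at t within {0..T})"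
      by (rule has_vector_derivative_diff)
    then show ?thesis
      unfolding f' by (subst time_deriv_def) (rule vector_derivative_within_closed_interval[OF T t])
  qed
  \<comment> \<open>The potential is continuous and the projection interpolates it, so the error has zero traces.\<close>
  have nodes: "((\<lambda>x. ?\<Phi> x - ?P x) \<longlongrightarrow> 0) (at_right (xn M (i - 1))) \<and>
      ((\<lambda>x. ?\<Phi> x - ?P x) \<longlongrightarrow> 0) (at_left (xn M i))" if i: "i \<in> {1..Nx M}" for i
  proof -
    have "continuous_on {xn M (i - 1)..xn M i} ?\<Phi>"
      using continuous_on_subset[OF potential_continuous[OF mesh g] cellJ_subset[OF mesh i]]
      by (simp add: cellJ_def)
    then have "(?\<Phi> \<longlongrightarrow> ?\<Phi> (xn M (i - 1))) (at (xn M (i - 1)) within {xn M (i - 1)..xn M i})"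
      "(?\<Phi> \<longlongrightarrow> ?\<Phi> (xn M i)) (at (xn M i) within {xn M (i - 1)..xn M i})"
      using xn_step[OF mesh i] by (simp_all add: continuous_on_def)
    then have "(?\<Phi> \<longlongrightarrow> ?\<Phi> (xn M (i - 1))) (at_right (xn M (i - 1)))"
      "(?\<Phi> \<longlongrightarrow> ?\<Phi> (xn M i)) (at_left (xn M i))"
      using xn_step[OF mesh i] by (simp_all add: at_within_Icc_at_right at_within_Icc_at_left)
    moreover have "(?P \<longlongrightarrow> ?\<Phi> (xn M (i - 1))) (at_right (xn M (i - 1)))"
      "(?P \<longlongrightarrow> ?\<Phi> (xn M i)) (at_left (xn M i))"
      using proj_nodes i unfolding agrees_at_nodes_def by auto
    ultimately show ?thesis
      using tendsto_diff[of ?\<Phi> "?\<Phi> (xn M (i - 1))" "at_right (xn M (i - 1))" ?P]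
        tendsto_diff[of ?\<Phi> "?\<Phi> (xn M i)" "at_left (xn M i)" ?P] by fastforce
  qed
  have Af: "A_form M (f t) (time_deriv T f t) (\<lambda>x. ?\<Phi> x - ?P x) = 0"
  proof (rule A_form_exact_solution[OF mesh slice[OF cf] slice[OF cfx] slice[OF cfv] _ _ _ cE])
    show "time_deriv T f t x v = E t x * fv t x v - v * fx t x v" for x v
      using deriv(4)[of x v] by (simp add: f')
  qed (use deriv(2,3) exact_supp[OF t] nodes piecewise_C1_diff[OF \<Phi> P] in auto)
  have "A_op M T t (\<lambda>s x v. fh s x v - f s x v) (\<lambda>x. ?\<Phi> x - ?P x)
      = A_form M ?g ?g' (\<lambda>x. ?\<Phi> x - ?P x) - A_form M (f t) (time_deriv T f t) (\<lambda>x. ?\<Phi> x - ?P x)"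
    unfolding A_op_eq_A_form
    by (rule A_form_diff_left[OF g g' f piecewise_C1_diff[OF \<Phi> P] diff'])
  then show "A_op M T t fh ?\<Phi> = A_op M T t (\<lambda>s x v. fh s x v - f s x v) (\<lambda>x. ?\<Phi> x - ?P x)"
    unfolding A_op_eq_A_form by (simp add: Af AP A_form_diff_right[OF g g' \<Phi> P])
qed

end
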